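(* Let $\mathbf F:\{-1,1\}^n\to\mathbb R^{\mathcal I\times\mathcal J}$ be a matrix-valued function whose entries $\mathbf F[I,J]$ are multilinear polynomials in $Z_1,\dots,Z_n$ of degree at most $d_p$, and let $Z$ be uniformly distributed on $\{-1,1\}^n$. Then for every integer $t\ge 1$, $$\mathbb E\,\big\|\mathbf F(Z)-\mathbb E\mathbf F\big\|_{2t}^{2t}\;\le\;\sum_{\substack{a,b\ge 0\\ 1\le a+b\le d_p}}(16\,t\,d_p)^{(a+b)t}\,\big\|\mathbb E\,\mathbf F_{a,b}\big\|_{2t}^{2t}.$$
   Context: $\mathcal I,\mathcal J$ are finite index sets. For $\alpha\in\{0,1\}^n$, $|\alpha|$ denotes the number of ones of $\alpha$, $\alpha\cdot\beta$ is the entrywise product, and $\nabla_\alpha=\prod_{i:\alpha_i=1}\frac{\partial}{\partial Z_i}$ (applied entrywise to matrices). $\mathbf F_{a,b}$ is the matrix with rows indexed by $\mathcal I\times\{0,1\}^n$ and columns by $\mathcal J\times\{0,1\}^n$ whose $[(I,\alpha),(J,\beta)]$ entry is $\nabla_{\alpha+\beta}\mathbf F[I,J]$ if $|\alpha|=a$, $|\beta|=b$ and $\alpha\cdot\beta=0$, and $0$ otherwise. For a real matrix $\mathbf M$, $\|\mathbf M\|_{2t}^{2t}=\operatorname{tr}\big((\mathbf M\mathbf M^\intercal)^t\big)$ (Schatten $2t$-norm to the power $2t$). *)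

theory Defs
  imports "HOL-Analysis.Analysis"
begin

definition cube :: "nat \<Rightarrow> (nat \<Rightarrow> real) set" where
  "cube n = ({..<n} \<rightarrow>\<^sub>E {-1, 1})"

definition expect :: "nat \<Rightarrow> ((nat \<Rightarrow> real) \<Rightarrow> real) \<Rightarrow> real" where
  "expect n f = (\<Sum>z\<in>cube n. f z) / 2 ^ n"

definition mlpoly :: "nat \<Rightarrow> (nat set \<Rightarrow> real) \<Rightarrow> (nat \<Rightarrow> real) \<Rightarrow> real" where
  "mlpoly n c z = (\<Sum>S\<in>Pow {..<n}. c S * (\<Prod>i\<in>S. z i))"

definition ml_degree_le :: "nat \<Rightarrow> (nat set \<Rightarrow> real) \<Rightarrow> nat \<Rightarrow> bool" where
  "ml_degree_le n c d \<longleftrightarrow> (\<forall>S. S \<subseteq> {..<n} \<longrightarrow> d < card S \<longrightarrow> c S = 0)"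

(* nabla_G = prod_{i in G} d/dZ_i applied to a multilinear polynomial, on coefficients:
   the monomial Z^S (S disjoint from G) gets coefficient c (S \<union> G). *)
definition ml_deriv :: "nat set \<Rightarrow> (nat set \<Rightarrow> real) \<Rightarrow> (nat set \<Rightarrow> real)" where
  "ml_deriv G c = (\<lambda>S. if S \<inter> G = {} then c (S \<union> G) else 0)"

definition gram :: "'c set \<Rightarrow> ('r \<Rightarrow> 'c \<Rightarrow> real) \<Rightarrow> 'r \<Rightarrow> 'r \<Rightarrow> real" where
  "gram C M = (\<lambda>x y. \<Sum>c\<in>C. M x c * M y c)"

fun mat_pow :: "'r set \<Rightarrow> ('r \<Rightarrow> 'r \<Rightarrow> real) \<Rightarrow> nat \<Rightarrow> 'r \<Rightarrow> 'r \<Rightarrow> real" where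
  "mat_pow R P 0 = (\<lambda>x y. if x = y then 1 else 0)"
| "mat_pow R P (Suc k) = (\<lambda>x y. \<Sum>w\<in>R. mat_pow R P k x w * P w y)"

(* ||M||_{2t}^{2t} = tr((M M^T)^t) *)
definition schatten_pow :: "'r set \<Rightarrow> 'c set \<Rightarrow> ('r \<Rightarrow> 'c \<Rightarrow> real) \<Rightarrow> nat \<Rightarrow> real" where
  "schatten_pow R C M t = (\<Sum>x\<in>R. mat_pow R (gram C M) t x x)"

(* The matrix E F_{a,b}: rows (I,A), columns (J,B), A,B \<subseteq> {..<n} encoding alpha, beta in {0,1}^n;
   F[I,J] has coefficients c I J. *)
definition EFab :: "nat \<Rightarrow> ('i \<Rightarrow> 'j \<Rightarrow> nat set \<Rightarrow> real) \<Rightarrow> nat \<Rightarrow> nat \<Rightarrow>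
    ('i \<times> nat set) \<Rightarrow> ('j \<times> nat set) \<Rightarrow> real" where
  "EFab n c a b = (\<lambda>(I, A) (J, B).
     if card A = a \<and> card B = b \<and> A \<inter> B = {}
     then expect n (\<lambda>z. mlpoly n (ml_deriv (A \<union> B) (c I J)) z) else 0)"

end

theory Submission
  imports Defs
begin

text \<open>Everything is reduced to the degree-\<open>k\<close> part of \<open>F\<close>, at the price of a factor \<open>4^(k t)\<close>, by
  convexity of \<open>tr X^(2t)\<close> with weights \<open>2^(-k)\<close>. For a \<open>k\<close>-homogeneous \<open>F\<close> pass to the Hermitian
  dilation \<open>X\<close> and write \<open>k X = \<Sum>i. z i D i\<close> (Euler), with \<open>D i\<close> the partial derivatives. Averaging
  \<open>tr (z i D i X^(2t-1))\<close> over the flip of \<open>z i\<close> and telescoping gives words \<open>tr (D W^q D Y^(2t-2-q))\<close>,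
  which are convex in \<open>q\<close> and hence dominated by their endpoints. With \<open>V = \<Sum>i. (D i)^2\<close> this
  yields \<open>k E tr X^(2t) \<le> (2t-1) E tr (V X^(2t-2))\<close>, and a trace Young inequality turns it
  into \<open>E tr X^(2t) \<le> ((2t-1)/k)^t E tr V^t\<close>. Applied to \<open>F\<^sub>a\<^sub>b\<close> the matrix \<open>V\<close> is block
  diagonal, with blocks \<open>b + 1\<close> times the Gram matrix of \<open>F\<^sub>a\<^sub>,\<^sub>b\<^sub>+\<^sub>1\<close> and \<open>a + 1\<close> times that of the
  transpose of \<open>F\<^sub>a\<^sub>+\<^sub>1\<^sub>,\<^sub>b\<close>; after \<open>k\<close> steps only constants are left. The convexity
  statements all come from \<open>2 tr (A^T B) \<le> tr (A^T A) + tr (B^T B)\<close>, so no spectral theory is needed.\<close>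

subsection \<open>Square matrices over a finite index set\<close>

text \<open>Entries outside \<open>R\<close> are set to 0, so that factors agreeing on
  \<open>R\<close> give products that are equal as functions. This makes it possible to rewrite
  inside powers and traces.\<close>

definition mmul :: "'k set \<Rightarrow> ('k \<Rightarrow> 'k \<Rightarrow> real) \<Rightarrow> ('k \<Rightarrow> 'k \<Rightarrow> real) \<Rightarrow> 'k \<Rightarrow> 'k \<Rightarrow> real" where
  "mmul R A B = (\<lambda>x y. if x \<in> R \<and> y \<in> R then \<Sum>w\<in>R. A x w * B w y else 0)"

definition mone :: "'k set \<Rightarrow> 'k \<Rightarrow> 'k \<Rightarrow> real" where
  "mone R = (\<lambda>x y. if x \<in> R \<and> x = y then 1 else 0)"

primrec mpow :: "'k set \<Rightarrow> ('k \<Rightarrow> 'k \<Rightarrow> real) \<Rightarrow> nat \<Rightarrow> 'k \<Rightarrow> 'k \<Rightarrow> real" where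
  "mpow R A 0 = mone R"
| "mpow R A (Suc k) = mmul R (mpow R A k) A"

definition mtr :: "'k set \<Rightarrow> ('k \<Rightarrow> 'k \<Rightarrow> real) \<Rightarrow> real" where
  "mtr R A = (\<Sum>x\<in>R. A x x)"

definition mtransp :: "('r \<Rightarrow> 'c \<Rightarrow> real) \<Rightarrow> 'c \<Rightarrow> 'r \<Rightarrow> real" where
  "mtransp A = (\<lambda>x y. A y x)"

lemma mtransp_mtransp [simp]: "mtransp (mtransp A) = A"
  by (simp add: mtransp_def)

lemma mmul_assoc: "mmul R (mmul R A B) C = mmul R A (mmul R B C)"
proof (intro ext)
  fix x y
  show "mmul R (mmul R A B) C x y = mmul R A (mmul R B C) x y"
  proof (cases "x \<in> R \<and> y \<in> R")
    case True
    have "mmul R (mmul R A B) C x y = (\<Sum>w\<in>R. (\<Sum>v\<in>R. A x v * B v w) * C w y)"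
      using True by (simp add: mmul_def)
    also have "\<dots> = (\<Sum>w\<in>R. \<Sum>v\<in>R. A x v * (B v w * C w y))"
      by (simp add: sum_distrib_right mult.assoc)
    also have "\<dots> = (\<Sum>v\<in>R. \<Sum>w\<in>R. A x v * (B v w * C w y))"
      by (rule sum.swap)
    also have "\<dots> = mmul R A (mmul R B C) x y"
      using True by (simp add: mmul_def sum_distrib_left)
    finally show ?thesis .
  qed (auto simp: mmul_def)
qed

lemma mtransp_mmul: "mtransp (mmul R A B) = mmul R (mtransp B) (mtransp A)"
  by (auto simp: mtransp_def mmul_def fun_eq_iff mult.commute intro!: sum.cong)

lemma mmul_cong:
  assumes "\<And>x y. x \<in> R \<Longrightarrow> y \<in> R \<Longrightarrow> A x y = A' x y" "\<And>x y. x \<in> R \<Longrightarrow> y \<in> R \<Longrightarrow> B x y = B' x y"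
  shows "mmul R A B = mmul R A' B'"
  using assms by (auto simp: mmul_def fun_eq_iff intro!: sum.cong)

lemma mpow_cong:
  assumes "\<And>x y. x \<in> R \<Longrightarrow> y \<in> R \<Longrightarrow> A x y = A' x y"
  shows "mpow R A k = mpow R A' k"
  by (induction k) (auto intro: mmul_cong assms)

lemma mtr_mmul: "mtr R (mmul R A B) = (\<Sum>x\<in>R. \<Sum>y\<in>R. A x y * B y x)"
  by (simp add: mtr_def mmul_def)

lemma mtr_mmul_commute: "mtr R (mmul R A B) = mtr R (mmul R B A)"
  unfolding mtr_mmul by (subst sum.swap) (simp add: mult.commute)

lemma mtr_mmul_cong:
  assumes "\<And>x y. x \<in> R \<Longrightarrow> y \<in> R \<Longrightarrow> A x y = A' x y"
  shows "mtr R (mmul R A B) = mtr R (mmul R A' B)"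
  using assms by (simp add: mtr_mmul)

lemma mtr_mmul_sum_left:
  "mtr R (mmul R (\<lambda>x y. \<Sum>i\<in>I. s i * A i x y) B) = (\<Sum>i\<in>I. s i * mtr R (mmul R (A i) B))"
proof -
  have "mtr R (mmul R (\<lambda>x y. \<Sum>i\<in>I. s i * A i x y) B)
      = (\<Sum>x\<in>R. \<Sum>y\<in>R. \<Sum>i\<in>I. s i * (A i x y * B y x))"
    by (simp add: mtr_mmul sum_distrib_right mult.assoc)
  also have "\<dots> = (\<Sum>x\<in>R. \<Sum>i\<in>I. \<Sum>y\<in>R. s i * (A i x y * B y x))"
    by (intro sum.cong refl sum.swap)
  also have "\<dots> = (\<Sum>i\<in>I. \<Sum>x\<in>R. \<Sum>y\<in>R. s i * (A i x y * B y x))"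
    by (rule sum.swap)
  finally show ?thesis
    by (simp add: mtr_mmul sum_distrib_left)
qed

lemma mtr_mmul_scale: "mtr R (mmul R (\<lambda>x y. s * A x y) B) = s * mtr R (mmul R A B)"
  by (simp add: mtr_mmul sum_distrib_left mult.assoc)

lemma mtr_mmul_diff:
  "mtr R (mmul R A B) - mtr R (mmul R A' B) = mtr R (mmul R (\<lambda>x y. A x y - A' x y) B)"
  by (simp add: mtr_mmul sum_subtractf left_diff_distrib)

lemma mpow_scale: "mpow R (\<lambda>x y. s * A x y) k = (\<lambda>x y. s ^ k * mpow R A k x y)"
  by (induction k) (auto simp: mmul_def fun_eq_iff sum_distrib_left algebra_simps)

lemma mtr_scale: "mtr R (\<lambda>x y. s * A x y) = s * mtr R A"
  by (simp add: mtr_def sum_distrib_left)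

lemma mtransp_mone: "mtransp (mone R) = mone R"
  by (auto simp: mtransp_def mone_def fun_eq_iff)

lemma mmul_mone:
  assumes "finite R"
  shows "mmul R (mone R) A = (\<lambda>x y. if x \<in> R \<and> y \<in> R then A x y else 0)"
    "mmul R A (mone R) = (\<lambda>x y. if x \<in> R \<and> y \<in> R then A x y else 0)"
proof -
  have "(\<Sum>w\<in>R. mone R x w * A w y) = A x y" if "x \<in> R" for x y
  proof -
    have "(\<Sum>w\<in>R. mone R x w * A w y) = (\<Sum>w\<in>R. if x = w then A w y else 0)"
      using that by (intro sum.cong) (auto simp: mone_def)
    then show ?thesis using that assms by simp
  qed
  then show "mmul R (mone R) A = (\<lambda>x y. if x \<in> R \<and> y \<in> R then A x y else 0)"
    unfolding mmul_def by (intro ext) simp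
  have "(\<Sum>w\<in>R. A x w * mone R w y) = A x y" if "y \<in> R" for x y
  proof -
    have "(\<Sum>w\<in>R. A x w * mone R w y) = (\<Sum>w\<in>R. if w = y then A x w else 0)"
      by (intro sum.cong) (auto simp: mone_def)
    then show ?thesis using that assms by simp
  qed
  then show "mmul R A (mone R) = (\<lambda>x y. if x \<in> R \<and> y \<in> R then A x y else 0)"
    unfolding mmul_def by (intro ext) simp
qed

text \<open>Products are cut down to \<open>R \<times> R\<close>, so the unit laws hold on products (and powers) without
  any support condition.\<close>

lemma mmul_mone_mmul [simp]:
  assumes "finite R"
  shows "mmul R (mone R) (mmul R A B) = mmul R A B" "mmul R (mmul R A B) (mone R) = mmul R A B"
    "mmul R A (mmul R (mone R) B) = mmul R A B"
proof -
  show "mmul R (mone R) (mmul R A B) = mmul R A B" "mmul R (mmul R A B) (mone R) = mmul R A B"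
    unfolding mmul_mone[OF assms] by (simp_all add: mmul_def fun_eq_iff)
  show "mmul R A (mmul R (mone R) B) = mmul R A B"
    unfolding mmul_mone[OF assms] by (rule mmul_cong) simp_all
qed

lemma mmul_mone_mpow [simp]:
  assumes "finite R"
  shows "mmul R (mone R) (mpow R A k) = mpow R A k" "mmul R (mpow R A k) (mone R) = mpow R A k"
proof -
  have *: "mmul R (mone R) (mone R) = mone R"
    unfolding mmul_mone[OF assms] by (intro ext) (auto simp: mone_def)
  show "mmul R (mone R) (mpow R A k) = mpow R A k"
    by (cases k) (simp_all only: mpow.simps * mmul_mone_mmul[OF assms])
  show "mmul R (mpow R A k) (mone R) = mpow R A k"
    by (cases k) (simp_all only: mpow.simps * mmul_mone_mmul[OF assms])
qed

lemma mpow_add: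
  assumes "finite R"
  shows "mpow R A (j + k) = mmul R (mpow R A j) (mpow R A k)"
  by (induction k) (simp_all add: assms mmul_assoc)

lemma mpow_Suc_left:
  assumes "finite R"
  shows "mpow R A (Suc k) = mmul R A (mpow R A k)"
proof (induction k)
  case 0
  show ?case
    by (simp only: mpow.simps mmul_mone[OF assms])
next
  case (Suc k)
  have "mpow R A (Suc (Suc k)) = mmul R (mmul R A (mpow R A k)) A"
    by (simp only: mpow.simps(2)[of R A "Suc k"] Suc)
  then show ?case by (simp add: mmul_assoc)
qed

lemma mpow_double:
  assumes "finite R"
  shows "mpow R A (2 * k) = mpow R (mmul R A A) k"
  by (induction k) (simp_all add: mmul_assoc)

lemma mtransp_mpow:
  assumes "finite R"
  shows "mtransp (mpow R A k) = mpow R (mtransp A) k"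
  by (induction k) (simp_all only: mpow.simps(1) mtransp_mone, 
    simp only: mpow.simps(2)[of R A] mpow_Suc_left[OF assms, of "mtransp A"] mtransp_mmul)

text \<open>\<open>mpow R A 1\<close> is \<open>A\<close> cut down to \<open>R\<close>, in general
  not \<open>A\<close> itself; under the trace the difference disappears.\<close>

lemma mtr_mmul_mpow_1:
  assumes "finite R"
  shows "mtr R (mmul R (mpow R A 1) B) = mtr R (mmul R A B)"
  by (rule mtr_mmul_cong) (simp add: mmul_mone[OF assms])

subsection \<open>Convexity of traces of words\<close>

text \<open>The trace of \<open>A^T B\<close> is the Frobenius inner product, so this is 2ab <= a^2
  + b^2 summed over the entries.\<close>

lemma mtr_amgm:
  "2 * mtr R (mmul R (mtransp A) B) \<le> mtr R (mmul R (mtransp A) A) + mtr R (mmul R (mtransp B) B)"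
proof -
  have "2 * mtr R (mmul R (mtransp A) B) = (\<Sum>x\<in>R. \<Sum>y\<in>R. 2 * A y x * B y x)"
    by (simp add: mtr_mmul mtransp_def sum_distrib_left mult.assoc)
  also have "\<dots> \<le> (\<Sum>x\<in>R. \<Sum>y\<in>R. A y x * A y x + B y x * B y x)"
    by (intro sum_mono) (metis sum_squares_bound power2_eq_square)
  finally show ?thesis
    by (simp add: mtr_mmul mtransp_def sum.distrib)
qed

lemma mtr_transp_mmul_nonneg: "mtr R (mmul R (mtransp A) A) \<ge> 0"
  by (simp add: mtr_mmul mtransp_def sum_nonneg)

text \<open>For symmetric \<open>A\<close> the power is \<open>B^T B\<close> with
  \<open>B = A^k\<close>, whose trace is a sum of squares.\<close>

lemma mtr_mpow_even_nonneg:
  assumes "finite R" "mtransp A = A"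
  shows "mtr R (mpow R A (2 * k)) \<ge> 0"
  using mtr_transp_mmul_nonneg[of R "mpow R A k"]
  by (simp only: mtransp_mpow assms mult_2 mpow_add)

text \<open>Induction on the right end \<open>M\<close>: the bound by the chord over [0, M] turns
  into the bound by the chord over [0, M + 1], because slopes measured from 0 do not
  decrease.\<close>

lemma convex_le_chord:
  fixes h :: "nat \<Rightarrow> real"
  assumes conv: "\<And>j. 0 < j \<Longrightarrow> j < M \<Longrightarrow> 2 * h j \<le> h (j - 1) + h (j + 1)" and "j \<le> M"
  shows "real M * h j \<le> real (M - j) * h 0 + real j * h M"
proof -
  show ?thesis
    using \<open>j \<le> M\<close> conv
  proof (induction M rule: dec_induct)
    case base
    then show ?case by simp
  next
    case (step M)
    \<comment> \<open>Denominators cleared, for i > 0: (h i - h 0) / i <= (h (i + 1) - h 0) / (i +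
      1).\<close>
    have *: "real (i + 1) * h i \<le> h 0 + real i * h (i + 1)" if "i \<le> M" for i
      using that
    proof (induction i)
      case (Suc i)
      have "real (i + 1) * (2 * h (i + 1)) \<le> real (i + 1) * (h i + h (i + 2))"
        using step.prems[of "i + 1"] Suc.prems by (intro mult_left_mono) auto
      with Suc show ?case by (simp add: algebra_simps)
    qed simp
    show ?case
    proof (cases "M = 0")
      case False
      have IH: "real M * h j \<le> real (M - j) * h 0 + real j * h M"
        using step by auto
      have "real M * (real (M + 1) * h j) = real (M + 1) * (real M * h j)"
        by simp
      also have "\<dots> \<le> real (M + 1) * (real (M - j) * h 0 + real j * h M)"
        using IH by (rule mult_left_mono) simp
      also have "\<dots> = real (M + 1) * real (M - j) * h 0 + real j * (real (M + 1) * h M)"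
        by (simp add: algebra_simps)
      also have "\<dots> \<le> real (M + 1) * real (M - j) * h 0 + real j * (h 0 + real M * h (M + 1))"
        using *[of M] by (intro add_left_mono mult_left_mono) auto
      also have "\<dots> = real M * (real (M + 1 - j) * h 0 + real j * h (M + 1))"
        using step.hyps by (simp add: of_nat_diff algebra_simps)
      finally show ?thesis using False by simp
    qed (use step in auto)
  qed
qed

text \<open>Words only offer two kinds of midpoint inequality: an odd point against its neighbours,
  an even point against the even points at distance 2. Along even points this is ordinary convexity;
  an odd point lies strictly below \<open>N\<close> and is handled by averaging the chord bounds of
  its two even neighbours.\<close>

lemma parity_convex_le_chord:
  fixes f :: "nat \<Rightarrow> real"
  assumes "even N" "q \<le> N"
    and odd: "\<And>q. odd q \<Longrightarrow> q < N \<Longrightarrow> 2 * f q \<le> f (q - 1) + f (q + 1)"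
    and even: "\<And>q. even q \<Longrightarrow> 0 < q \<Longrightarrow> q < N \<Longrightarrow> 2 * f q \<le> f (q - 2) + f (q + 2)"
  shows "real N * f q \<le> real (N - q) * f 0 + real q * f N"
proof -
  obtain M where M: "N = 2 * M" using \<open>even N\<close> by blast
  have E: "real M * f (2 * j) \<le> real (M - j) * f 0 + real j * f N" if "j \<le> M" for j
  proof -
    have "2 * f (2 * j) \<le> f (2 * (j - 1)) + f (2 * (j + 1))" if "0 < j" "j < M" for j
      using even[of "2 * j"] that M by (simp add: diff_mult_distrib2)
    from convex_le_chord[of M "\<lambda>j. f (2 * j)" j, OF this that] show ?thesis
      by (simp add: M)
  qed
  show ?thesis
  proof (cases "even q")
    case True
    then obtain j where "q = 2 * j" by blast
    with E[of j] \<open>q \<le> N\<close> M show ?thesis by (auto simp: of_nat_diff algebra_simps)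
  next
    case False
    then obtain j where j: "q = 2 * j + 1" by (metis oddE)
    have lt: "q < N" using \<open>q \<le> N\<close> False \<open>even N\<close> by (metis le_neq_implies_less)
    have "real M * (2 * f q) \<le> real M * (f (q - 1) + f (q + 1))"
      using odd[OF False lt] by (rule mult_left_mono) simp
    also have "\<dots> = real M * f (2 * j) + real M * f (2 * (j + 1))"
      by (simp add: j algebra_simps)
    also have "\<dots> \<le> (real (M - j) * f 0 + real j * f N) + (real (M - (j + 1)) * f 0 + real (j + 1) * f N)"
      using lt M j by (intro add_mono E) auto
    also have "\<dots> = real (N - q) * f 0 + real q * f N"
      using lt by (simp add: M j of_nat_diff algebra_simps)
    finally show ?thesis by (simp add: M)
  qed
qed

text \<open>The vectors \<open>W^p H Y^s\<close> have Frobenius products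
  \<open>tr (H W^(p+p') H Y^(s+s'))\<close>. Hence \<open>mtr_amgm\<close> compares the word at p +
  p' with those at 2p and 2p', which are always even; this forces the parity version of the chord
  bound.\<close>

lemma mtr_word_le_chord:
  assumes fin: "finite R" and sym: "mtransp H = H" "mtransp W = W" "mtransp Y = Y"
    and "even N" "q \<le> N"
  defines "f \<equiv> \<lambda>q. mtr R (mmul R H (mmul R (mpow R W q) (mmul R H (mpow R Y (N - q)))))"
  shows "real N * f q \<le> real (N - q) * f 0 + real q * f N"
proof -
  define u where "u = (\<lambda>p s. mmul R (mpow R W p) (mmul R H (mpow R Y s)))"
  have inner: "mtr R (mmul R (mtransp (u p s)) (u p' s')) = f (p + p')"
    if "s + s' = N - (p + p')" for p p' s s'
  proof -
    have "mtr R (mmul R (mtransp (u p s)) (u p' s'))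
        = mtr R (mmul R (mpow R Y s) (mmul R H (mmul R (mpow R W (p + p')) (mmul R H (mpow R Y s')))))"
      by (simp only: u_def mtransp_mmul mtransp_mpow fin sym mmul_assoc mpow_add[OF fin])
    also have "\<dots> = mtr R (mmul R H (mmul R (mpow R W (p + p')) (mmul R H (mmul R (mpow R Y s') (mpow R Y s)))))"
      by (subst mtr_mmul_commute) (simp only: mmul_assoc)
    also have "\<dots> = f (p + p')"
      by (simp only: f_def that[symmetric] mpow_add[OF fin, symmetric] add.commute[of s s'])
    finally show ?thesis .
  qed
  obtain l where l: "N = 2 * l" using \<open>even N\<close> by blast
  \<comment> \<open>With N = 2l the exponents s = l - p and s' = l - p' make the total length right
    for all three words at once.\<close>
  have mid: "2 * f q \<le> f r + f r'" if "q = p + p'" "r = p + p" "r' = p' + p'" "p \<le> l" "p' \<le> l" for q r r' p p'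
    using mtr_amgm[of R "u p (l - p)" "u p' (l - p')"] that l
    by (simp add: inner)
  have "2 * f q \<le> f (q - 1) + f (q + 1)" if q: "odd q" "q < N" for q
  proof -
    obtain j where j: "q = 2 * j + 1" using q by (metis oddE)
    show ?thesis
      by (rule mid[of _ j "j + 1"]) (use j l q in linarith)+
  qed
  moreover have "2 * f q \<le> f (q - 2) + f (q + 2)" if q: "even q" "0 < q" "q < N" for q
  proof -
    obtain j where j: "q = 2 * j" using q by blast
    show ?thesis
      by (rule mid[of _ "j - 1" "j + 1"]) (use j l q in linarith)+
  qed
  ultimately show ?thesis
    using \<open>even N\<close> \<open>q \<le> N\<close> by (intro parity_convex_le_chord) auto
qed

text \<open>The chord bounds are summed over \<open>q\<close>; by the symmetry of \<open>q\<close>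
  and \<open>N - q\<close> both endpoints receive the weight (N + 1) / 2. At an endpoint one power
  is trivial and the two factors \<open>H\<close> meet cyclically.\<close>

lemma sum_mtr_word_le:
  assumes fin: "finite R" and sym: "mtransp H = H" "mtransp W = W" "mtransp Y = Y" and "even N"
  shows "(\<Sum>q\<le>N. mtr R (mmul R H (mmul R (mpow R W q) (mmul R H (mpow R Y (N - q))))))
    \<le> real (N + 1) / 2 * (mtr R (mmul R (mmul R H H) (mpow R W N)) + mtr R (mmul R (mmul R H H) (mpow R Y N)))"
proof -
  define f where "f = (\<lambda>q. mtr R (mmul R H (mmul R (mpow R W q) (mmul R H (mpow R Y (N - q))))))"
  have f0: "f 0 = mtr R (mmul R (mmul R H H) (mpow R Y N))"
    by (simp add: f_def fin mmul_assoc)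
  have fN: "f N = mtr R (mmul R (mmul R H H) (mpow R W N))"
  proof -
    have "f N = mtr R (mmul R H (mmul R (mpow R W N) (mmul R H (mone R))))"
      by (simp add: f_def)
    also have "\<dots> = mtr R (mmul R (mmul R H (mmul R (mpow R W N) H)) (mone R))"
      by (simp only: mmul_assoc)
    also have "\<dots> = mtr R (mmul R H (mmul R (mpow R W N) H))"
      by (simp only: mmul_mone_mmul[OF fin])
    also have "\<dots> = mtr R (mmul R (mmul R (mpow R W N) H) H)"
      by (rule mtr_mmul_commute)
    also have "\<dots> = mtr R (mmul R (mpow R W N) (mmul R H H))"
      by (simp only: mmul_assoc)
    also have "\<dots> = mtr R (mmul R (mmul R H H) (mpow R W N))"
      by (rule mtr_mmul_commute)
    finally show ?thesis .
  qed
  have "(\<Sum>q\<le>N. f q) \<le> real (N + 1) / 2 * (f N + f 0)"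
  proof (cases "N = 0")
    case False
    have "real N * (\<Sum>q\<le>N. f q) \<le> (\<Sum>q\<le>N. real (N - q) * f 0 + real q * f N)"
      unfolding sum_distrib_left f_def
      using mtr_word_le_chord[OF fin sym \<open>even N\<close>] by (intro sum_mono) auto
    also have "\<dots> = (\<Sum>q\<le>N. real (N - q)) * f 0 + (\<Sum>q\<le>N. real q) * f N"
      by (simp add: sum.distrib sum_distrib_right)
    also have "(\<Sum>q\<le>N. real (N - q)) = (\<Sum>q\<le>N. real q)"
      by (rule sum.reindex_bij_witness[of _ "\<lambda>q. N - q" "\<lambda>q. N - q"]) auto
    also have "(\<Sum>q\<le>N. real q) = real N * real (N + 1) / 2"
      using double_gauss_sum[of N, where ?'a = real] by (simp add: atLeast0AtMost mult.commute)
    finally have "real N * (\<Sum>q\<le>N. f q) \<le> real N * (real (N + 1) / 2 * (f N + f 0))"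
      by (simp add: field_simps)
    then show ?thesis using False by simp
  qed simp
  then show ?thesis by (simp only: f0 fN) (simp only: f_def)
qed

text \<open>The chord bound for words with the identity as \<open>H\<close>, length 2m, at the point
  q = 1.\<close>

lemma mtr_young:
  assumes fin: "finite R" and sym: "mtransp X = X" "mtransp Y = Y" and m: "m \<ge> 1"
  shows "real (2 * m) * mtr R (mmul R X (mpow R Y (2 * m - 1)))
    \<le> mtr R (mpow R X (2 * m)) + real (2 * m - 1) * mtr R (mpow R Y (2 * m))"
proof -
  have "real (2 * m) * mtr R (mmul R (mpow R X 1) (mpow R Y (2 * m - 1)))
    \<le> real (2 * m - 1) * mtr R (mpow R Y (2 * m)) + mtr R (mpow R X (2 * m))"
    using mtr_word_le_chord[OF fin mtransp_mone[of R] sym, of "2 * m" 1] m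
    by (simp add: fin del: mpow.simps(2))
  then show ?thesis
    by (simp only: mtr_mmul_mpow_1[OF fin] add.commute)
qed

text \<open>Expand one factor of \<open>tr Y^(2m)\<close>, apply \<open>mtr_young\<close> to each
  \<open>tr (X k Y^(2m-1))\<close>, and absorb the resulting multiple of \<open>tr Y^(2m)\<close> on
  the left.\<close>

lemma mtr_mpow_convex:
  assumes fin: "finite R" and m: "m \<ge> 1"
    and w: "\<And>k. k \<in> K \<Longrightarrow> w k \<ge> 0" "sum w K \<le> 1"
    and sym: "\<And>k. k \<in> K \<Longrightarrow> mtransp (X k) = X k"
  shows "mtr R (mpow R (\<lambda>x y. \<Sum>k\<in>K. w k * X k x y) (2 * m)) \<le> (\<Sum>k\<in>K. w k * mtr R (mpow R (X k) (2 * m)))"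
proof -
  define Y where "Y = (\<lambda>x y. \<Sum>k\<in>K. w k * X k x y)"
  define y where "y = mtr R (mpow R Y (2 * m))"
  have symY: "mtransp Y = Y"
    unfolding Y_def mtransp_def
    by (intro ext sum.cong refl) (metis sym mtransp_def)
  have pos: "0 \<le> real (2 * m - 1) * mtr R (mpow R Y (2 * m))"
    using mtr_mpow_even_nonneg[OF fin symY] by simp
  have "mpow R Y (2 * m) = mmul R Y (mpow R Y (2 * m - 1))"
    using mpow_Suc_left[OF fin, of Y "2 * m - 1"] m by simp
  then have "real (2 * m) * y = real (2 * m) * (\<Sum>k\<in>K. w k * mtr R (mmul R (X k) (mpow R Y (2 * m - 1))))"
    by (simp add: y_def Y_def mtr_mmul_sum_left)
  also have "\<dots> = (\<Sum>k\<in>K. w k * (real (2 * m) * mtr R (mmul R (X k) (mpow R Y (2 * m - 1)))))"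
    unfolding sum_distrib_left by (intro sum.cong) auto
  also have "\<dots> \<le> (\<Sum>k\<in>K. w k * (mtr R (mpow R (X k) (2 * m)) + real (2 * m - 1) * y))"
    unfolding y_def using w sym symY m by (intro sum_mono mult_left_mono mtr_young fin) auto
  also have "\<dots> = (\<Sum>k\<in>K. w k * mtr R (mpow R (X k) (2 * m))) + sum w K * (real (2 * m - 1) * y)"
    by (simp add: distrib_left sum.distrib sum_distrib_right)
  \<comment> \<open>Weights with sum at most 1 are enough here because \<open>tr Y^(2m)\<close> is
    nonnegative.\<close>
  also have "\<dots> \<le> (\<Sum>k\<in>K. w k * mtr R (mpow R (X k) (2 * m))) + 1 * (real (2 * m - 1) * y)"
    using w(2) pos unfolding y_def by (intro add_left_mono mult_right_mono)
  finally show ?thesis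
    using m by (simp add: y_def Y_def of_nat_diff left_diff_distrib)
qed

text \<open>The traces \<open>f a = tr (V^a X^(2(m-a)))\<close> are convex in \<open>a\<close>, and
  the claim is the chord bound at a = 1. For odd \<open>a\<close> convexity comes from
  \<open>mtr_amgm\<close>; for even \<open>a\<close> the neighbours are odd powers of
  \<open>V\<close>, and the form \<open>tr (A^T V B)\<close> of hypothesis \<open>psd\<close> takes
  the place of a square root of \<open>V\<close>.\<close>

lemma mtr_psd_young:
  assumes fin: "finite R" and sym: "mtransp V = V" "mtransp X = X" and m: "m \<ge> 1"
    and psd: "\<And>A B. 2 * mtr R (mmul R (mtransp A) (mmul R V B))
      \<le> mtr R (mmul R (mtransp A) (mmul R V A)) + mtr R (mmul R (mtransp B) (mmul R V B))"
  shows "real m * mtr R (mmul R V (mpow R X (2 * (m - 1))))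
    \<le> mtr R (mpow R V m) + real (m - 1) * mtr R (mpow R X (2 * m))"
proof -
  define f where "f = (\<lambda>a. mtr R (mmul R (mpow R V a) (mpow R X (2 * (m - a)))))"
  define u where "u = (\<lambda>p s. mmul R (mpow R V p) (mpow R X s))"
  have inner: "mtr R (mmul R (mtransp (u p s)) (u p' s')) = f (p + p')"
    if "s + s' = 2 * (m - (p + p'))" for p p' s s'
  proof -
    have "mtr R (mmul R (mtransp (u p s)) (u p' s'))
        = mtr R (mmul R (mpow R X s) (mmul R (mpow R V (p + p')) (mpow R X s')))"
      by (simp only: u_def mtransp_mmul mtransp_mpow fin sym mmul_assoc mpow_add[OF fin])
    also have "\<dots> = mtr R (mmul R (mpow R V (p + p')) (mmul R (mpow R X s') (mpow R X s)))"
      by (subst mtr_mmul_commute) (simp only: mmul_assoc)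
    also have "\<dots> = f (p + p')"
      by (simp only: f_def that[symmetric] mpow_add[OF fin, symmetric] add.commute[of s s'])
    finally show ?thesis .
  qed
  have innerV: "mtr R (mmul R (mtransp (u p s)) (mmul R V (u p' s'))) = f (Suc (p + p'))"
    if "s + s' = 2 * (m - Suc (p + p'))" for p p' s s'
  proof -
    have "mmul R V (u p' s') = u (Suc p') s'"
      by (simp only: u_def mpow_Suc_left[OF fin] mmul_assoc)
    then show ?thesis using inner[of s s' p "Suc p'"] that by simp
  qed
  have mid: "2 * f a \<le> f b + f b'"
    if "a = p + p'" "b = p + p" "b' = p' + p'" "p + p \<le> m" "p' + p' \<le> m" for a b b' p p'
  proof -
    have "(m - (p + p)) + (m - (p' + p')) = 2 * (m - (p + p'))"
      using that by linarith
    then show ?thesis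
      using mtr_amgm[of R "u p (m - (p + p))" "u p' (m - (p' + p'))"] that
      by (simp add: inner)
  qed
  have midV: "2 * f a \<le> f b + f b'"
    if "a = Suc (p + p')" "b = Suc (p + p)" "b' = Suc (p' + p')" "Suc (p + p) \<le> m" "Suc (p' + p') \<le> m"
    for a b b' p p'
  proof -
    have "(m - Suc (p + p)) + (m - Suc (p' + p')) = 2 * (m - Suc (p + p'))"
      using that by linarith
    then show ?thesis
      using psd[of "u p (m - Suc (p + p))" "u p' (m - Suc (p' + p'))"] that
      by (simp add: innerV)
  qed
  have "2 * f a \<le> f (a - 1) + f (a + 1)" if a: "0 < a" "a < m" for a
  proof (cases "odd a")
    case True
    then obtain j where j: "a = 2 * j + 1" by (metis oddE)
    show ?thesis
      by (rule mid[of _ j "j + 1"]) (use j a in linarith)+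
  next
    case False
    then obtain j where j: "a = 2 * j" by blast
    show ?thesis
      by (rule midV[of _ "j - 1" "j"]) (use j a in linarith)+
  qed
  from convex_le_chord[of m f 1, OF this m]
  have "real m * f 1 \<le> real (m - 1) * f 0 + f m" by simp
  moreover have "f 0 = mtr R (mpow R X (2 * m))" "f m = mtr R (mpow R V m)"
    by (simp_all add: f_def fin)
  moreover have "f 1 = mtr R (mmul R V (mpow R X (2 * (m - 1))))"
    unfolding f_def by (rule mtr_mmul_mpow_1[OF fin])
  ultimately show ?thesis by simp
qed

text \<open>Supplies hypothesis \<open>psd\<close> of \<open>mtr_psd_young\<close>: since
  \<open>D i\<close> is symmetric, \<open>tr (A^T (D i)^2 B)\<close> is the Frobenius product of
  \<open>D i A\<close> and \<open>D i B\<close>, and \<open>mtr_amgm\<close> applies to each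
  summand.\<close>

lemma sum_squares_psd:
  fixes R :: "'k set" and D :: "'a \<Rightarrow> 'k \<Rightarrow> 'k \<Rightarrow> real" and s :: real
  assumes sym: "\<And>i. i \<in> I \<Longrightarrow> mtransp (D i) = D i" and "s \<ge> 0"
  defines "V \<equiv> \<lambda>x y. s * (\<Sum>i\<in>I. mmul R (D i) (D i) x y)"
  shows "2 * mtr R (mmul R (mtransp A) (mmul R V B))
      \<le> mtr R (mmul R (mtransp A) (mmul R V A)) + mtr R (mmul R (mtransp B) (mmul R V B))"
proof -
  have V: "V = (\<lambda>x y. \<Sum>i\<in>I. s * mmul R (D i) (D i) x y)"
    by (simp add: V_def sum_distrib_left)
  have *: "mtr R (mmul R (mtransp A) (mmul R V B))
      = (\<Sum>i\<in>I. s * mtr R (mmul R (mtransp (mmul R (D i) A)) (mmul R (D i) B)))" for A B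
  proof -
    have "mtr R (mmul R (mtransp A) (mmul R V B)) = mtr R (mmul R V (mmul R B (mtransp A)))"
      by (subst mtr_mmul_commute) (simp only: mmul_assoc)
    also have "\<dots> = (\<Sum>i\<in>I. s * mtr R (mmul R (mmul R (D i) (D i)) (mmul R B (mtransp A))))"
      by (simp only: V mtr_mmul_sum_left)
    also have "\<dots> = (\<Sum>i\<in>I. s * mtr R (mmul R (mtransp (mmul R (D i) A)) (mmul R (D i) B)))"
    proof (intro sum.cong refl arg_cong2[of _ _ _ _ "(*)"])
      fix i assume "i \<in> I"
      have "mtr R (mmul R (mmul R (D i) (D i)) (mmul R B (mtransp A)))
          = mtr R (mmul R (mmul R (D i) (mmul R (D i) B)) (mtransp A))"
        by (simp only: mmul_assoc)
      also have "\<dots> = mtr R (mmul R (mtransp A) (mmul R (D i) (mmul R (D i) B)))"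
        by (rule mtr_mmul_commute)
      finally show "mtr R (mmul R (mmul R (D i) (D i)) (mmul R B (mtransp A)))
          = mtr R (mmul R (mtransp (mmul R (D i) A)) (mmul R (D i) B))"
        by (simp only: mtransp_mmul sym[OF \<open>i \<in> I\<close>] mmul_assoc)
    qed
    finally show ?thesis .
  qed
  show ?thesis
    unfolding * sum.distrib[symmetric] distrib_left[symmetric] sum_distrib_left mult.left_commute[of 2]
    using \<open>s \<ge> 0\<close> by (intro sum_mono mult_left_mono mtr_amgm) auto
qed

text \<open>Telescoping over the hybrids \<open>W^q Y^(N+1-q)\<close>: consecutive hybrids differ in
  a single factor, which contributes W - Y = s H.\<close>

lemma mtr_mpow_diff:
  assumes fin: "finite R" and WY: "\<And>x y. W x y - Y x y = s * H x y"
  shows "mtr R (mmul R H (mpow R W (Suc N))) - mtr R (mmul R H (mpow R Y (Suc N)))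
    = s * (\<Sum>q\<le>N. mtr R (mmul R H (mmul R (mpow R W q) (mmul R H (mpow R Y (N - q))))))"
proof -
  define g where "g = (\<lambda>q. mtr R (mmul R H (mmul R (mpow R W q) (mpow R Y (Suc N - q)))))"
  have step: "g (Suc q) - g q
      = s * mtr R (mmul R H (mmul R (mpow R W q) (mmul R H (mpow R Y (N - q)))))" if "q \<le> N" for q
  proof -
    let ?Q = "mmul R (mpow R Y (N - q)) (mmul R H (mpow R W q))"
    \<comment> \<open>Cyclicity brings the factor \<open>Z\<close> in which the two hybrids differ
      (\<open>W\<close> or \<open>Y\<close>) to the front, where the trace is linear in it.\<close>
    have rot: "mtr R (mmul R H (mmul R (mpow R W q) (mmul R Z (mpow R Y (N - q))))) = mtr R (mmul R Z ?Q)" for Z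
    proof -
      have "mtr R (mmul R H (mmul R (mpow R W q) (mmul R Z (mpow R Y (N - q)))))
          = mtr R (mmul R (mmul R H (mpow R W q)) (mmul R Z (mpow R Y (N - q))))"
        by (simp only: mmul_assoc)
      also have "\<dots> = mtr R (mmul R (mmul R Z (mpow R Y (N - q))) (mmul R H (mpow R W q)))"
        by (rule mtr_mmul_commute)
      finally show ?thesis by (simp only: mmul_assoc)
    qed
    have "g (Suc q) = mtr R (mmul R W ?Q)"
      unfolding rot[symmetric] by (simp add: g_def mmul_assoc)
    moreover have "g q = mtr R (mmul R Y ?Q)"
      unfolding rot[symmetric] mpow_Suc_left[OF fin, symmetric] using that by (simp only: g_def Suc_diff_le)
    ultimately have "g (Suc q) - g q = mtr R (mmul R (\<lambda>x y. s * H x y) ?Q)"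
      by (simp only: mtr_mmul_diff WY)
    then show ?thesis by (simp only: mtr_mmul_scale rot)
  qed
  have "g (Suc N) - g 0 = (\<Sum>q\<le>N. g (Suc q) - g q)"
    using sum_lessThan_telescope[of g "Suc N"] by (simp only: lessThan_Suc_atMost)
  also have "\<dots> = s * (\<Sum>q\<le>N. mtr R (mmul R H (mmul R (mpow R W q) (mmul R H (mpow R Y (N - q))))))"
    unfolding sum_distrib_left by (intro sum.cong refl step) simp
  finally show ?thesis
    by (simp add: g_def fin del: mpow.simps(2))
qed

subsection \<open>Moments of symmetric matrix-valued functions on the cube\<close>

definition flip :: "nat \<Rightarrow> (nat \<Rightarrow> real) \<Rightarrow> nat \<Rightarrow> real" where
  "flip i z = z(i := - z i)"

lemma finite_cube [simp]: "finite (cube n)"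
  by (simp add: cube_def finite_PiE)

lemma cube_cases: "z \<in> cube n \<Longrightarrow> i < n \<Longrightarrow> z i = 1 \<or> z i = -1"
  by (auto simp: cube_def)

lemma flip_in_cube: "z \<in> cube n \<Longrightarrow> i < n \<Longrightarrow> flip i z \<in> cube n"
  by (auto simp: cube_def flip_def PiE_iff extensional_def)

lemma flip_flip [simp]: "flip i (flip i z) = z"
  by (simp add: flip_def)

lemma expect_flip:
  assumes "i < n"
  shows "expect n (\<lambda>z. f (flip i z)) = expect n f"
  unfolding expect_def
  by (intro arg_cong2[of _ _ _ _ "(/)"] refl sum.reindex_bij_witness[of _ "flip i" "flip i"])
    (simp_all add: flip_in_cube assms)

lemma expect_mono: "(\<And>z. z \<in> cube n \<Longrightarrow> f z \<le> g z) \<Longrightarrow> expect n f \<le> expect n g"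
  by (simp add: expect_def divide_right_mono sum_mono)

lemma expect_cong: "(\<And>z. z \<in> cube n \<Longrightarrow> f z = g z) \<Longrightarrow> expect n f = expect n g"
  by (simp add: expect_def)

lemma expect_add: "expect n (\<lambda>z. f z + g z) = expect n f + expect n g"
  by (simp add: expect_def sum.distrib add_divide_distrib)

lemma expect_cmult: "expect n (\<lambda>z. s * f z) = s * expect n f"
  by (simp add: expect_def sum_distrib_left)

lemma expect_sum: "expect n (\<lambda>z. \<Sum>i\<in>I. f i z) = (\<Sum>i\<in>I. expect n (f i))"
  unfolding expect_def by (subst sum.swap) (simp add: sum_divide_distrib)

text \<open>Pair \<open>z\<close> with \<open>flip i z\<close>. Only the sign of \<open>z i\<close>
  and the power of \<open>X\<close> change, so the pair sums to \<open>z i\<close> times a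
  difference of powers; this telescopes with W - Y = 2 (z i) D, and (z i)^2 = 1. The endpoints of
  the word sum belong to \<open>z\<close> and to \<open>flip i z\<close>, which have the same
  expectation.\<close>

lemma expect_coordinate_le:
  assumes fin: "finite R" and i: "i < n"
    and symX: "\<And>z. z \<in> cube n \<Longrightarrow> mtransp (X z) = X z"
    and symD: "\<And>z. z \<in> cube n \<Longrightarrow> mtransp (D z) = D z"
    and diff: "\<And>z x y. z \<in> cube n \<Longrightarrow> X z x y - X (flip i z) x y = 2 * z i * D z x y"
    and flipD: "\<And>z. z \<in> cube n \<Longrightarrow> D (flip i z) = D z"
    and "even N"
  shows "expect n (\<lambda>z. z i * mtr R (mmul R (D z) (mpow R (X z) (Suc N))))
    \<le> real (Suc N) * expect n (\<lambda>z. mtr R (mmul R (mmul R (D z) (D z)) (mpow R (X z) N)))"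
proof -
  define h where "h = (\<lambda>z. z i * mtr R (mmul R (D z) (mpow R (X z) (Suc N))))"
  define k where "k = (\<lambda>z. mtr R (mmul R (mmul R (D z) (D z)) (mpow R (X z) N)))"
  have hk: "h z + h (flip i z) \<le> real (Suc N) * (k z + k (flip i z))" if z: "z \<in> cube n" for z
  proof -
    have zz: "z i * z i = 1" using cube_cases[OF z i] by auto
    have fi: "flip i z i = - z i" by (simp add: flip_def)
    have fz: "flip i z \<in> cube n" using flip_in_cube[OF z i] .
    have "h z + h (flip i z)
        = z i * (mtr R (mmul R (D z) (mpow R (X z) (Suc N))) - mtr R (mmul R (D z) (mpow R (X (flip i z)) (Suc N))))"
      by (simp add: h_def flipD[OF z] fi right_diff_distrib del: mpow.simps(2))
    also have "\<dots> = z i * ((2 * z i) * (\<Sum>q\<le>N. mtr R (mmul R (D z) (mmul R (mpow R (X z) q)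
          (mmul R (D z) (mpow R (X (flip i z)) (N - q)))))))"
      by (subst mtr_mpow_diff[OF fin diff[OF z]]) (rule refl)
    also have "\<dots> = 2 * (z i * z i) * (\<Sum>q\<le>N. mtr R (mmul R (D z) (mmul R (mpow R (X z) q)
          (mmul R (D z) (mpow R (X (flip i z)) (N - q))))))"
      by (simp only: mult.assoc mult.left_commute)
    also have "\<dots> = 2 * (\<Sum>q\<le>N. mtr R (mmul R (D z) (mmul R (mpow R (X z) q)
          (mmul R (D z) (mpow R (X (flip i z)) (N - q))))))"
      by (simp add: zz)
    also have "\<dots> \<le> 2 * (real (N + 1) / 2 * (mtr R (mmul R (mmul R (D z) (D z)) (mpow R (X z) N))
        + mtr R (mmul R (mmul R (D z) (D z)) (mpow R (X (flip i z)) N))))"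
      by (intro mult_left_mono sum_mtr_word_le fin symX symD z fz \<open>even N\<close>) simp
    also have "\<dots> = real (Suc N) * (k z + k (flip i z))"
      by (simp add: k_def flipD[OF z])
    finally show ?thesis .
  qed
  have "2 * expect n h = expect n (\<lambda>z. h z + h (flip i z))"
    by (simp add: expect_add expect_flip[OF i])
  also have "\<dots> \<le> expect n (\<lambda>z. real (Suc N) * (k z + k (flip i z)))"
    by (rule expect_mono) (rule hk)
  also have "\<dots> = real (Suc N) * (2 * expect n k)"
    by (simp only: expect_cmult expect_add expect_flip[OF i]) simp
  finally show ?thesis by (simp add: h_def k_def)
qed

text \<open>Expanding one factor of \<open>X^(2m)\<close> by \<open>euler\<close> and bounding each
  coordinate gives \<open>s E tr X^(2m) <= (2m-1) E tr (V X^(2m-2))\<close>. Young's inequality then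
  removes the mixed term.\<close>

lemma expect_mtr_mpow_le:
  assumes fin: "finite R" and m: "m \<ge> 1" and s: "s > 0"
    and symX: "\<And>z. z \<in> cube n \<Longrightarrow> mtransp (X z) = X z"
    and symD: "\<And>i z. i < n \<Longrightarrow> z \<in> cube n \<Longrightarrow> mtransp (D i z) = D i z"
    and diff: "\<And>i z x y. i < n \<Longrightarrow> z \<in> cube n \<Longrightarrow> X z x y - X (flip i z) x y = 2 * z i * D i z x y"
    and flipD: "\<And>i z. i < n \<Longrightarrow> z \<in> cube n \<Longrightarrow> D i (flip i z) = D i z"
    and euler: "\<And>z x y. z \<in> cube n \<Longrightarrow> x \<in> R \<Longrightarrow> y \<in> R \<Longrightarrow> s * X z x y = (\<Sum>i<n. z i * D i z x y)"
  shows "expect n (\<lambda>z. mtr R (mpow R (X z) (2 * m)))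
    \<le> (real (2 * m - 1) / s) ^ m * expect n (\<lambda>z. mtr R (mpow R (\<lambda>x y. \<Sum>i<n. mmul R (D i z) (D i z) x y) m))"
proof -
  define N where "N = 2 * (m - 1)"
  have N: "Suc (Suc N) = 2 * m" "Suc N = 2 * m - 1" "even N" using m by (auto simp: N_def)
  define V where "V = (\<lambda>z x y. \<Sum>i<n. mmul R (D i z) (D i z) x y)"
  define r where "r = real (2 * m - 1) / s"
  have r: "r \<ge> 0" using s by (simp add: r_def)
  define e where "e = expect n (\<lambda>z. mtr R (mpow R (X z) (2 * m)))"
  have "s * e = expect n (\<lambda>z. \<Sum>i<n. z i * mtr R (mmul R (D i z) (mpow R (X z) (Suc N))))"
    unfolding e_def expect_cmult[symmetric]
  proof (rule expect_cong)
    fix z assume z: "z \<in> cube n"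
    have "s * mtr R (mpow R (X z) (2 * m)) = s * mtr R (mmul R (X z) (mpow R (X z) (Suc N)))"
      by (simp only: N(1)[symmetric] mpow_Suc_left[OF fin, of _ "Suc N"])
    also have "\<dots> = mtr R (mmul R (\<lambda>x y. \<Sum>i<n. z i * D i z x y) (mpow R (X z) (Suc N)))"
      unfolding mtr_mmul_scale[symmetric] by (rule mtr_mmul_cong) (rule euler[OF z])
    finally show "s * mtr R (mpow R (X z) (2 * m)) = (\<Sum>i<n. z i * mtr R (mmul R (D i z) (mpow R (X z) (Suc N))))"
      by (simp only: mtr_mmul_sum_left)
  qed
  also have "\<dots> = (\<Sum>i<n. expect n (\<lambda>z. z i * mtr R (mmul R (D i z) (mpow R (X z) (Suc N)))))"
    by (rule expect_sum)
  also have "\<dots> \<le> (\<Sum>i<n. real (Suc N) * expect n (\<lambda>z. mtr R (mmul R (mmul R (D i z) (D i z)) (mpow R (X z) N))))"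
    by (intro sum_mono expect_coordinate_le fin symX symD diff flipD N(3)) auto
  also have "\<dots> = real (Suc N) * expect n (\<lambda>z. \<Sum>i<n. mtr R (mmul R (mmul R (D i z) (D i z)) (mpow R (X z) N)))"
    by (simp only: sum_distrib_left expect_sum)
  also have "\<dots> = real (Suc N) * expect n (\<lambda>z. mtr R (mmul R (V z) (mpow R (X z) N)))"
    by (simp only: V_def mtr_mmul_sum_left[of R "\<lambda>_. 1" _ "{..<n}", simplified])
  finally have "e \<le> r * expect n (\<lambda>z. mtr R (mmul R (V z) (mpow R (X z) N)))"
    using s by (simp only: r_def N(2)) (simp add: field_simps)
  then have "real m * e \<le> real m * (r * expect n (\<lambda>z. mtr R (mmul R (V z) (mpow R (X z) N))))"
    by (rule mult_left_mono) simp
  \<comment> \<open>Young is applied to \<open>r V\<close> instead of \<open>V\<close>: the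
    remainder is then exactly (m - 1) \<open>e\<close>, leaving one copy of \<open>e\<close> out of
    the m on the left.\<close>
  also have "\<dots> = expect n (\<lambda>z. real m * mtr R (mmul R (\<lambda>x y. r * V z x y) (mpow R (X z) N)))"
    by (simp only: mtr_mmul_scale expect_cmult)
  also have "\<dots> \<le> expect n (\<lambda>z. r ^ m * mtr R (mpow R (V z) m) + real (m - 1) * mtr R (mpow R (X z) (2 * m)))"
  proof (rule expect_mono)
    fix z assume z: "z \<in> cube n"
    have symV: "mtransp (\<lambda>x y. r * V z x y) = (\<lambda>x y. r * V z x y)"
    proof -
      have "mmul R (D i z) (D i z) y x = mmul R (D i z) (D i z) x y" if "i < n" for i x y
        using mtransp_mmul[of R "D i z" "D i z"] unfolding symD[OF that z]
        by (metis mtransp_def)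
      then show ?thesis
        unfolding mtransp_def V_def by (intro ext arg_cong2[of _ _ _ _ "(*)"] sum.cong refl) auto
    qed
    have "real m * mtr R (mmul R (\<lambda>x y. r * V z x y) (mpow R (X z) N))
        \<le> mtr R (mpow R (\<lambda>x y. r * V z x y) m) + real (m - 1) * mtr R (mpow R (X z) (2 * m))"
      unfolding N_def
      by (intro mtr_psd_young[OF fin symV symX[OF z] m])
        (unfold V_def, intro sum_squares_psd r symD z, simp)
    then show "real m * mtr R (mmul R (\<lambda>x y. r * V z x y) (mpow R (X z) N))
        \<le> r ^ m * mtr R (mpow R (V z) m) + real (m - 1) * mtr R (mpow R (X z) (2 * m))"
      by (simp only: mpow_scale mtr_scale)
  qed
  also have "\<dots> = r ^ m * expect n (\<lambda>z. mtr R (mpow R (V z) m)) + real (m - 1) * e"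
    by (simp only: expect_add expect_cmult e_def)
  finally have "e \<le> r ^ m * expect n (\<lambda>z. mtr R (mpow R (V z) m))"
    using m by (simp add: of_nat_diff left_diff_distrib)
  then show ?thesis by (simp only: e_def r_def V_def)
qed

subsection \<open>Hermitian dilation\<close>

text \<open>The block matrix with \<open>M\<close> and its transpose off the diagonal. It is
  symmetric even for rectangular \<open>M\<close>, so the moment bounds above apply to it.\<close>

definition dilation :: "('r \<Rightarrow> 'c \<Rightarrow> real) \<Rightarrow> 'r + 'c \<Rightarrow> 'r + 'c \<Rightarrow> real" where
  "dilation M = (\<lambda>x y. case x of
     Inl r \<Rightarrow> (case y of Inl _ \<Rightarrow> 0 | Inr c \<Rightarrow> M r c)
   | Inr c \<Rightarrow> (case y of Inl r \<Rightarrow> M r c | Inr _ \<Rightarrow> 0))"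

definition block_diag :: "('r \<Rightarrow> 'r \<Rightarrow> real) \<Rightarrow> ('c \<Rightarrow> 'c \<Rightarrow> real) \<Rightarrow> 'r + 'c \<Rightarrow> 'r + 'c \<Rightarrow> real" where
  "block_diag P Q = (\<lambda>x y. case x of
     Inl r \<Rightarrow> (case y of Inl r' \<Rightarrow> P r r' | Inr _ \<Rightarrow> 0)
   | Inr c \<Rightarrow> (case y of Inl _ \<Rightarrow> 0 | Inr c' \<Rightarrow> Q c c'))"

lemma mtransp_dilation [simp]: "mtransp (dilation M) = dilation M"
  by (auto simp: mtransp_def dilation_def fun_eq_iff split: sum.splits)

lemma sum_Plus_Inl_Inr:
  assumes "finite R" "finite C"
  shows "(\<Sum>w\<in>R <+> C. f w) = (\<Sum>r\<in>R. f (Inl r)) + (\<Sum>c\<in>C. f (Inr c))"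
  using assms by (simp add: sum.Plus)

lemma mmul_dilation:
  assumes "finite R" "finite C" "x \<in> R <+> C" "y \<in> R <+> C"
  shows "mmul (R <+> C) (dilation M) (dilation M) x y = block_diag (gram C M) (gram R (mtransp M)) x y"
  using assms
  by (cases x; cases y)
    (auto simp: mmul_def sum_Plus_Inl_Inr dilation_def block_diag_def gram_def mtransp_def)

lemma mmul_block_diag:
  assumes "finite R" "finite C"
  shows "mmul (R <+> C) (block_diag P Q) (block_diag P' Q') = block_diag (mmul R P P') (mmul C Q Q')"
proof (intro ext)
  show "mmul (R <+> C) (block_diag P Q) (block_diag P' Q') x y = block_diag (mmul R P P') (mmul C Q Q') x y" for x y
    using assms by (cases x; cases y) (auto simp: mmul_def sum_Plus_Inl_Inr block_diag_def)
qed

lemma mpow_block_diag: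
  assumes "finite R" "finite C"
  shows "mpow (R <+> C) (block_diag P Q) k = block_diag (mpow R P k) (mpow C Q k)"
proof (induction k)
  case 0
  have "mone (R <+> C) x y = block_diag (mone R) (mone C) x y" for x y
    by (cases x; cases y) (auto simp: mone_def block_diag_def)
  then show ?case by (simp add: fun_eq_iff)
qed (simp add: mmul_block_diag[OF assms])

lemma mtr_block_diag:
  assumes "finite R" "finite C"
  shows "mtr (R <+> C) (block_diag P Q) = mtr R P + mtr C Q"
  using assms by (simp add: mtr_def sum_Plus_Inl_Inr block_diag_def)

section \<open>Schatten powers: transposition, dilation, convexity, zero padding\<close>

lemma schatten_pow_eq_mtr: "schatten_pow R C M t = mtr R (mpow R (gram C M) t)"
proof -
  have "x \<in> R \<Longrightarrow> y \<in> R \<Longrightarrow> mat_pow R P k x y = mpow R P k x y" for P x y k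
    by (induction k arbitrary: x y) (auto simp: mone_def mmul_def)
  then show ?thesis by (simp add: schatten_pow_def mtr_def)
qed

text \<open>This is \<open>(M M^T)^(k+1) = M (M^T M)^k M^T\<close>, written in entries because
  \<open>mmul\<close> multiplies only matrices over one common index set.\<close>

lemma mpow_gram_Suc:
  assumes "finite R" "finite C" "x \<in> R" "y \<in> R"
  shows "mpow R (gram C M) (Suc k) x y
    = (\<Sum>b\<in>C. \<Sum>e\<in>C. M x b * mpow C (gram R (mtransp M)) k b e * M y e)"
  using \<open>y \<in> R\<close>
proof (induction k arbitrary: y)
  case 0
  have "(\<Sum>e\<in>C. M x b * mone C b e * M y e) = M x b * M y b" if "b \<in> C" for b
  proof -
    have "(\<Sum>e\<in>C. M x b * mone C b e * M y e) = (\<Sum>e\<in>C. if b = e then M x e * M y e else 0)"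
      using that by (intro sum.cong) (auto simp: mone_def)
    then show ?thesis using that assms by simp
  qed
  then show ?case
    using assms 0 by (simp add: mmul_mone gram_def)
next
  case (Suc k)
  let ?P = "mpow C (gram R (mtransp M)) k"
  have "mpow R (gram C M) (Suc (Suc k)) x y = (\<Sum>w\<in>R. mpow R (gram C M) (Suc k) x w * gram C M w y)"
    unfolding mpow.simps(2)[of R _ "Suc k"] using \<open>x \<in> R\<close> Suc.prems by (simp add: mmul_def)
  also have "\<dots> = (\<Sum>w\<in>R. \<Sum>b\<in>C. \<Sum>g\<in>C. \<Sum>e\<in>C. M x b * ?P b g * M w g * (M w e * M y e))"
  proof (intro sum.cong refl)
    fix w assume "w \<in> R"
    have "mpow R (gram C M) (Suc k) x w * gram C M w y
        = (\<Sum>b\<in>C. \<Sum>g\<in>C. M x b * ?P b g * M w g) * (\<Sum>e\<in>C. M w e * M y e)"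
      by (simp only: Suc.IH[OF \<open>w \<in> R\<close>]) (simp only: gram_def)
    then show "mpow R (gram C M) (Suc k) x w * gram C M w y
        = (\<Sum>b\<in>C. \<Sum>g\<in>C. \<Sum>e\<in>C. M x b * ?P b g * M w g * (M w e * M y e))"
      by (simp only: sum_distrib_right) (simp only: sum_distrib_left)
  qed
  also have "\<dots> = (\<Sum>b\<in>C. \<Sum>w\<in>R. \<Sum>g\<in>C. \<Sum>e\<in>C. M x b * ?P b g * M w g * (M w e * M y e))"
    by (rule sum.swap)
  also have "\<dots> = (\<Sum>b\<in>C. \<Sum>e\<in>C. M x b * mpow C (gram R (mtransp M)) (Suc k) b e * M y e)"
  proof (intro sum.cong refl)
    fix b assume b: "b \<in> C"
    have "(\<Sum>w\<in>R. \<Sum>g\<in>C. \<Sum>e\<in>C. M x b * ?P b g * M w g * (M w e * M y e))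
        = (\<Sum>w\<in>R. \<Sum>e\<in>C. \<Sum>g\<in>C. M x b * ?P b g * M w g * (M w e * M y e))"
      by (intro sum.cong refl sum.swap)
    also have "\<dots> = (\<Sum>e\<in>C. \<Sum>w\<in>R. \<Sum>g\<in>C. M x b * ?P b g * M w g * (M w e * M y e))"
      by (rule sum.swap)
    also have "\<dots> = (\<Sum>e\<in>C. \<Sum>g\<in>C. \<Sum>w\<in>R. M x b * ?P b g * M w g * (M w e * M y e))"
      by (intro sum.cong refl sum.swap)
    also have "\<dots> = (\<Sum>e\<in>C. M x b * mpow C (gram R (mtransp M)) (Suc k) b e * M y e)"
    proof (intro sum.cong refl)
      fix e assume e: "e \<in> C"
      have "mpow C (gram R (mtransp M)) (Suc k) b e = (\<Sum>g\<in>C. ?P b g * (\<Sum>w\<in>R. M w g * M w e))"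
        using b e by (simp add: mmul_def) (simp add: gram_def mtransp_def)
      then have "M x b * mpow C (gram R (mtransp M)) (Suc k) b e * M y e
          = (\<Sum>g\<in>C. M x b * (?P b g * (\<Sum>w\<in>R. M w g * M w e)) * M y e)"
        by (simp only: sum_distrib_left sum_distrib_right)
      also have "\<dots> = (\<Sum>g\<in>C. \<Sum>w\<in>R. M x b * (?P b g * (M w g * M w e)) * M y e)"
        by (simp only: sum_distrib_left sum_distrib_right)
      finally show "(\<Sum>g\<in>C. \<Sum>w\<in>R. M x b * ?P b g * M w g * (M w e * M y e))
          = M x b * mpow C (gram R (mtransp M)) (Suc k) b e * M y e"
        by (simp only: mult.assoc)
    qed
    finally show "(\<Sum>w\<in>R. \<Sum>g\<in>C. \<Sum>e\<in>C. M x b * ?P b g * M w g * (M w e * M y e))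
        = (\<Sum>e\<in>C. M x b * mpow C (gram R (mtransp M)) (Suc k) b e * M y e)" .
  qed
  finally show ?case .
qed

text \<open>Cyclicity of the trace applied to \<open>M (M^T M)^k M^T\<close>. For t = 0 the two
  sides would be the cardinalities of \<open>C\<close> and \<open>R\<close>.\<close>

lemma schatten_pow_mtransp:
  assumes "finite R" "finite C" "t \<ge> 1"
  shows "schatten_pow C R (mtransp M) t = schatten_pow R C M t"
proof -
  obtain k where t: "t = Suc k" using \<open>t \<ge> 1\<close> by (cases t) auto
  let ?P = "mpow C (gram R (mtransp M)) k"
  have "schatten_pow R C M t = (\<Sum>x\<in>R. \<Sum>b\<in>C. \<Sum>e\<in>C. M x b * ?P b e * M x e)"
    unfolding schatten_pow_eq_mtr mtr_def t by (intro sum.cong refl mpow_gram_Suc assms)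
  also have "\<dots> = (\<Sum>b\<in>C. \<Sum>x\<in>R. \<Sum>e\<in>C. M x b * ?P b e * M x e)"
    by (rule sum.swap)
  also have "\<dots> = (\<Sum>b\<in>C. \<Sum>e\<in>C. \<Sum>x\<in>R. M x b * ?P b e * M x e)"
    by (intro sum.cong refl sum.swap)
  also have "\<dots> = (\<Sum>b\<in>C. \<Sum>e\<in>C. ?P b e * (\<Sum>x\<in>R. M x e * M x b))"
    unfolding sum_distrib_left by (intro sum.cong refl) (simp only: mult.assoc mult.left_commute mult.commute)
  also have "\<dots> = (\<Sum>b\<in>C. \<Sum>e\<in>C. ?P b e * gram R (mtransp M) e b)"
    by (intro sum.cong refl arg_cong2[of _ _ _ _ "(*)"]) (simp add: gram_def mtransp_def)
  also have "\<dots> = schatten_pow C R (mtransp M) t"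
    by (simp only: schatten_pow_eq_mtr t mtr_mmul mpow.simps)
  finally show ?thesis by simp
qed

text \<open>The square of the dilation is block diagonal with blocks \<open>M M^T\<close> and
  \<open>M^T M\<close>, whose powers have equal traces.\<close>

lemma mtr_mpow_dilation:
  assumes "finite R" "finite C" "t \<ge> 1"
  shows "mtr (R <+> C) (mpow (R <+> C) (dilation M) (2 * t)) = 2 * schatten_pow R C M t"
proof -
  have fin: "finite (R <+> C)" using assms by simp
  have "mpow (R <+> C) (dilation M) (2 * t) = mpow (R <+> C) (block_diag (gram C M) (gram R (mtransp M))) t"
    unfolding mpow_double[OF fin] by (rule mpow_cong) (rule mmul_dilation[OF assms(1,2)])
  then show ?thesis
    using schatten_pow_mtransp[OF assms, of M]
    by (simp add: mpow_block_diag mtr_block_diag assms schatten_pow_eq_mtr)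
qed

lemma schatten_pow_nonneg:
  assumes "finite R" "finite C" "t \<ge> 1"
  shows "schatten_pow R C M t \<ge> 0"
  using mtr_mpow_even_nonneg[of "R <+> C" "dilation M" t] mtr_mpow_dilation[OF assms, of M] assms
  by simp

lemma schatten_pow_scale:
  "schatten_pow R C (\<lambda>x y. s * M x y) t = s ^ (2 * t) * schatten_pow R C M t"
proof -
  have "gram C (\<lambda>x y. s * M x y) = (\<lambda>x y. s\<^sup>2 * gram C M x y)"
    by (simp add: gram_def fun_eq_iff sum_distrib_left power2_eq_square ac_simps)
  then show ?thesis
    by (simp add: schatten_pow_eq_mtr mpow_scale mtr_scale power_mult)
qed

lemma schatten_pow_cong:
  assumes "\<And>x y. x \<in> R \<Longrightarrow> y \<in> C \<Longrightarrow> M x y = M' x y"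
  shows "schatten_pow R C M t = schatten_pow R C M' t"
  unfolding schatten_pow_eq_mtr
  by (rule arg_cong[where f = "mtr R"], rule mpow_cong) (simp add: gram_def assms)

text \<open>The dilation is linear in \<open>M\<close>, so this is \<open>mtr_mpow_convex\<close>
  with both sides halved.\<close>

lemma schatten_pow_convex:
  assumes fin: "finite R" "finite C" and t: "t \<ge> 1"
    and w: "\<And>k. k \<in> K \<Longrightarrow> w k \<ge> 0" "sum w K \<le> 1"
  shows "schatten_pow R C (\<lambda>x y. \<Sum>k\<in>K. w k * M k x y) t \<le> (\<Sum>k\<in>K. w k * schatten_pow R C (M k) t)"
proof -
  have "dilation (\<lambda>x y. \<Sum>k\<in>K. w k * M k x y) = (\<lambda>x y. \<Sum>k\<in>K. w k * dilation (M k) x y)"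
    by (auto simp: dilation_def fun_eq_iff split: sum.splits)
  moreover have "mtr (R <+> C) (mpow (R <+> C) (\<lambda>x y. \<Sum>k\<in>K. w k * dilation (M k) x y) (2 * t))
      \<le> (\<Sum>k\<in>K. w k * mtr (R <+> C) (mpow (R <+> C) (dilation (M k)) (2 * t)))"
    using fin t w by (intro mtr_mpow_convex) auto
  ultimately have "2 * schatten_pow R C (\<lambda>x y. \<Sum>k\<in>K. w k * M k x y) t
      \<le> (\<Sum>k\<in>K. w k * (2 * schatten_pow R C (M k) t))"
    by (simp only: mtr_mpow_dilation[OF fin t, symmetric])
  also have "\<dots> = 2 * (\<Sum>k\<in>K. w k * schatten_pow R C (M k) t)"
    by (simp add: sum_distrib_left mult.left_commute)
  finally show ?thesis by simp
qed

lemma schatten_pow_zero_padding: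
  assumes fin: "finite R" "finite C" and t: "t \<ge> 1"
    and f: "inj_on f R'" "f ` R' \<subseteq> R" and g: "inj_on g C'" "g ` C' \<subseteq> C"
    and zero: "\<And>x y. x \<in> R \<Longrightarrow> y \<in> C \<Longrightarrow> x \<notin> f ` R' \<or> y \<notin> g ` C' \<Longrightarrow> M x y = 0"
  shows "schatten_pow R C M t = schatten_pow R' C' (\<lambda>x y. M (f x) (g y)) t"
proof -
  define P where "P = gram C M"
  define P' where "P' = gram C' (\<lambda>x y. M (f x) (g y))"
  have P: "P (f x) (f y) = P' x y" if "x \<in> R'" "y \<in> R'" for x y
  proof -
    have "P (f x) (f y) = (\<Sum>c\<in>g ` C'. M (f x) c * M (f y) c)"
      unfolding P_def gram_def using that fin f g zero by (intro sum.mono_neutral_right) auto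
    then show ?thesis
      by (simp add: P'_def gram_def sum.reindex[OF g(1)])
  qed
  have P0: "P x y = 0" if "x \<in> R" "y \<in> R" "x \<notin> f ` R'" for x y
    unfolding P_def gram_def using that by (intro sum.neutral) (simp add: zero)
  have P0': "P x y = 0" if "x \<in> R" "y \<in> R" "y \<notin> f ` R'" for x y
    unfolding P_def gram_def using that by (intro sum.neutral) (simp add: zero)
  have pow: "mpow R P k (f x) (f y) = mpow R' P' k x y" if "x \<in> R'" "y \<in> R'" for x y k
    using that
  proof (induction k arbitrary: y)
    case 0
    then show ?case using f by (auto simp: mone_def inj_on_def)
  next
    case (Suc k)
    have "f x \<in> R" "f y \<in> R" using Suc.prems f by auto
    then have "mpow R P (Suc k) (f x) (f y) = (\<Sum>w\<in>R. mpow R P k (f x) w * P w (f y))"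
      by (simp add: mmul_def)
    also have "\<dots> = (\<Sum>w\<in>f ` R'. mpow R P k (f x) w * P w (f y))"
      using fin f P0 \<open>f y \<in> R\<close> by (intro sum.mono_neutral_right) auto
    also have "\<dots> = (\<Sum>w\<in>R'. mpow R' P' k x w * P' w y)"
      unfolding sum.reindex[OF f(1)] using Suc by (intro sum.cong) (auto simp: P)
    finally show ?case using Suc.prems by (simp add: mmul_def)
  qed
  obtain k where k: "t = Suc k" using t by (cases t) auto
  have "mtr R (mpow R P t) = (\<Sum>x\<in>f ` R'. mpow R P t x x)"
    unfolding mtr_def k
  proof (rule sum.mono_neutral_right[OF fin(1) f(2)])
    show "\<forall>x\<in>R - f ` R'. mpow R P (Suc k) x x = 0"
      by (auto simp: mmul_def intro!: sum.neutral P0')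
  qed
  also have "\<dots> = mtr R' (mpow R' P' t)"
    by (simp add: mtr_def sum.reindex[OF f(1)] pow)
  finally show ?thesis by (simp add: schatten_pow_eq_mtr P_def P'_def)
qed

subsection \<open>Multilinear polynomials on the cube\<close>

lemma mlpoly_split:
  assumes "i < n"
  shows "mlpoly n c z = mlpoly n (\<lambda>S. if i \<in> S then 0 else c S) z + z i * mlpoly n (ml_deriv {i} c) z"
proof -
  have "mlpoly n c z = mlpoly n (\<lambda>S. if i \<in> S then 0 else c S) z + mlpoly n (\<lambda>S. if i \<in> S then c S else 0) z"
    unfolding mlpoly_def sum.distrib[symmetric] by (intro sum.cong) auto
  also have "mlpoly n (\<lambda>S. if i \<in> S then c S else 0) z = (\<Sum>S\<in>{S \<in> Pow {..<n}. i \<in> S}. c S * (\<Prod>j\<in>S. z j))"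
    unfolding mlpoly_def by (rule sum.mono_neutral_cong_right) auto
  also have "\<dots> = (\<Sum>S\<in>{S \<in> Pow {..<n}. i \<notin> S}. z i * (c (insert i S) * (\<Prod>j\<in>S. z j)))"
  proof (rule sum.reindex_bij_witness[of _ "insert i" "\<lambda>S. S - {i}"])
    fix S assume "S \<in> {S \<in> Pow {..<n}. i \<in> S}"
    then have "finite S" "i \<in> S" by (auto intro: finite_subset)
    then show "z i * (c (insert i (S - {i})) * (\<Prod>j\<in>S - {i}. z j)) = c S * (\<Prod>j\<in>S. z j)"
      by (simp add: insert_absorb prod.remove[of S i])
  qed (use assms in auto)
  also have "\<dots> = z i * mlpoly n (ml_deriv {i} c) z"
    unfolding mlpoly_def sum_distrib_left
    by (rule sum.mono_neutral_cong_left) (auto simp: ml_deriv_def)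
  finally show ?thesis .
qed

lemma mlpoly_flip:
  assumes "\<And>S. i \<in> S \<Longrightarrow> c S = 0"
  shows "mlpoly n c (flip i z) = mlpoly n c z"
  unfolding mlpoly_def
proof (intro sum.cong refl)
  show "c S * (\<Prod>j\<in>S. flip i z j) = c S * (\<Prod>j\<in>S. z j)" for S
    by (cases "i \<in> S") (auto simp: assms flip_def intro!: prod.cong)
qed

text \<open>Both polynomials in \<open>mlpoly_split\<close> are free of the variable
  \<open>z i\<close>, so the flip only negates the factor in front of the derivative.\<close>

lemma mlpoly_diff_flip:
  assumes "i < n"
  shows "mlpoly n c z - mlpoly n c (flip i z) = 2 * z i * mlpoly n (ml_deriv {i} c) z"
proof -
  have "mlpoly n (ml_deriv {i} c) (flip i z) = mlpoly n (ml_deriv {i} c) z"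
    by (rule mlpoly_flip) (simp add: ml_deriv_def)
  moreover have "mlpoly n (\<lambda>S. if i \<in> S then 0 else c S) (flip i z) = mlpoly n (\<lambda>S. if i \<in> S then 0 else c S) z"
    by (rule mlpoly_flip) simp
  ultimately show ?thesis
    unfolding mlpoly_split[OF assms, of c] by (simp add: flip_def)
qed

text \<open>The monomial of \<open>S\<close> reappears on the right once for each \<open>i\<close>
  in \<open>S\<close>, hence \<open>k\<close> times.\<close>

lemma mlpoly_euler:
  assumes "\<And>S. S \<subseteq> {..<n} \<Longrightarrow> card S \<noteq> k \<Longrightarrow> c S = 0"
  shows "real k * mlpoly n c z = (\<Sum>i<n. z i * mlpoly n (ml_deriv {i} c) z)"
proof -
  have "z i * mlpoly n (ml_deriv {i} c) z = (\<Sum>S\<in>Pow {..<n}. (if i \<in> S then 1 else 0) * (c S * (\<Prod>j\<in>S. z j)))"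
    if "i < n" for i
  proof -
    have "z i * mlpoly n (ml_deriv {i} c) z = mlpoly n c z - mlpoly n (\<lambda>S. if i \<in> S then 0 else c S) z"
      using mlpoly_split[OF that, of c z] by simp
    also have "\<dots> = (\<Sum>S\<in>Pow {..<n}. (if i \<in> S then 1 else 0) * (c S * (\<Prod>j\<in>S. z j)))"
      unfolding mlpoly_def sum_subtractf[symmetric] by (intro sum.cong) auto
    finally show ?thesis .
  qed
  then have "(\<Sum>i<n. z i * mlpoly n (ml_deriv {i} c) z)
      = (\<Sum>i<n. \<Sum>S\<in>Pow {..<n}. (if i \<in> S then 1 else 0) * (c S * (\<Prod>j\<in>S. z j)))"
    by (intro sum.cong) auto
  also have "\<dots> = (\<Sum>S\<in>Pow {..<n}. \<Sum>i<n. (if i \<in> S then 1 else 0) * (c S * (\<Prod>j\<in>S. z j)))"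
    by (rule sum.swap)
  also have "\<dots> = (\<Sum>S\<in>Pow {..<n}. real k * (c S * (\<Prod>j\<in>S. z j)))"
  proof (intro sum.cong refl)
    fix S assume S: "S \<in> Pow {..<n}"
    have "(\<Sum>i<n. (if i \<in> S then 1 else 0 :: real)) = real (card S)"
      using S by (simp add: sum.If_cases Int_absorb1)
    then show "(\<Sum>i<n. (if i \<in> S then 1 else 0) * (c S * (\<Prod>j\<in>S. z j))) = real k * (c S * (\<Prod>j\<in>S. z j))"
      using assms[of S] S unfolding sum_distrib_right[symmetric] by auto
  qed
  finally show ?thesis by (simp add: mlpoly_def sum_distrib_left)
qed

section \<open>Expectations and iterated derivatives of multilinear polynomials\<close>

lemma card_cube: "card (cube n) = 2 ^ n"
  by (simp add: cube_def card_PiE numeral_2_eq_2)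

lemma expect_const: "expect n (\<lambda>_. s) = s"
  by (simp add: expect_def card_cube)

text \<open>A nonconstant monomial changes sign when one of its variables is flipped, so its
  expectation is 0.\<close>

lemma expect_mlpoly: "expect n (mlpoly n c) = c {}"
proof -
  have mono: "expect n (\<lambda>z. \<Prod>j\<in>S. z j) = 0" if S: "S \<subseteq> {..<n}" "S \<noteq> {}" for S
  proof -
    obtain i where i: "i \<in> S" using S by blast
    have fin: "finite S" using S by (auto intro: finite_subset)
    have "(\<Prod>j\<in>S. flip i z j) = (-1) * (\<Prod>j\<in>S. z j)" for z
      unfolding prod.remove[OF fin i] by (simp add: flip_def)
    then have "expect n (\<lambda>z. \<Prod>j\<in>S. z j) = (-1) * expect n (\<lambda>z. \<Prod>j\<in>S. z j)"
      using expect_flip[of i n "\<lambda>z. \<Prod>j\<in>S. z j"] i S by (auto simp only: expect_cmult)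
    then show ?thesis by simp
  qed
  have "expect n (mlpoly n c) = (\<Sum>S\<in>Pow {..<n}. c S * expect n (\<lambda>z. \<Prod>j\<in>S. z j))"
    unfolding mlpoly_def[abs_def] expect_sum expect_cmult ..
  also have "\<dots> = (\<Sum>S\<in>{{}}. c S * expect n (\<lambda>z. \<Prod>j\<in>S. z j))"
    by (rule sum.mono_neutral_right) (auto simp: mono)
  finally show ?thesis by (simp add: expect_const)
qed

lemma ml_deriv_singleton:
  "ml_deriv {i} (ml_deriv G c) = (if i \<in> G then (\<lambda>_. 0) else ml_deriv (insert i G) c)"
  by (auto simp: ml_deriv_def fun_eq_iff insert_commute)

text \<open>Double counting: \<open>B\<close> arises as \<open>insert i (B - {i})\<close> once for
  each of its elements.\<close>

lemma sum_Pow_insert: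
  fixes g :: "nat set \<Rightarrow> real"
  assumes "finite N"
  shows "(\<Sum>i\<in>N. \<Sum>B\<in>Pow N. if i \<notin> B then g (insert i B) else 0) = (\<Sum>B\<in>Pow N. real (card B) * g B)"
proof -
  have "(\<Sum>B\<in>Pow N. if i \<notin> B then g (insert i B) else 0) = (\<Sum>B\<in>Pow N. if i \<in> B then g B else 0)"
    if "i \<in> N" for i
  proof -
    have "(\<Sum>B\<in>Pow N. if i \<notin> B then g (insert i B) else 0) = (\<Sum>B\<in>{B \<in> Pow N. i \<notin> B}. g (insert i B))"
      using assms by (intro sum.mono_neutral_cong_right) auto
    also have "\<dots> = (\<Sum>B\<in>{B \<in> Pow N. i \<in> B}. g B)"
      by (rule sum.reindex_bij_witness[of _ "\<lambda>B. B - {i}" "insert i"]) (use that in \<open>auto simp: insert_absorb\<close>)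
    also have "\<dots> = (\<Sum>B\<in>Pow N. if i \<in> B then g B else 0)"
      using assms by (intro sum.mono_neutral_cong_left) auto
    finally show ?thesis .
  qed
  then have "(\<Sum>i\<in>N. \<Sum>B\<in>Pow N. if i \<notin> B then g (insert i B) else 0)
      = (\<Sum>i\<in>N. \<Sum>B\<in>Pow N. if i \<in> B then g B else 0)"
    by (rule sum.cong[OF refl])
  also have "\<dots> = (\<Sum>B\<in>Pow N. \<Sum>i\<in>N. if i \<in> B then g B else 0)"
    by (rule sum.swap)
  also have "\<dots> = (\<Sum>B\<in>Pow N. real (card B) * g B)"
  proof (intro sum.cong refl)
    fix B assume "B \<in> Pow N"
    then show "(\<Sum>i\<in>N. if i \<in> B then g B else 0) = real (card B) * g B"
      using assms by (simp add: sum.If_cases Int_absorb1)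
  qed
  finally show ?thesis .
qed

subsection \<open>The matrices of partial derivatives\<close>

definition Fab :: "nat \<Rightarrow> ('i \<Rightarrow> 'j \<Rightarrow> nat set \<Rightarrow> real) \<Rightarrow> nat \<Rightarrow> nat \<Rightarrow> (nat \<Rightarrow> real) \<Rightarrow>
    ('i \<times> nat set) \<Rightarrow> ('j \<times> nat set) \<Rightarrow> real" where
  "Fab n c a b z = (\<lambda>(I, A) (J, B).
     if card A = a \<and> card B = b \<and> A \<inter> B = {} then mlpoly n (ml_deriv (A \<union> B) (c I J)) z else 0)"

definition DFab :: "nat \<Rightarrow> ('i \<Rightarrow> 'j \<Rightarrow> nat set \<Rightarrow> real) \<Rightarrow> nat \<Rightarrow> nat \<Rightarrow> nat \<Rightarrow> (nat \<Rightarrow> real) \<Rightarrow>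
    ('i \<times> nat set) \<Rightarrow> ('j \<times> nat set) \<Rightarrow> real" where
  "DFab n c a b i z = (\<lambda>(I, A) (J, B).
     if card A = a \<and> card B = b \<and> A \<inter> B = {} then mlpoly n (ml_deriv {i} (ml_deriv (A \<union> B) (c I J))) z else 0)"

definition homogeneous :: "nat \<Rightarrow> (nat set \<Rightarrow> real) \<Rightarrow> bool" where
  "homogeneous k c \<longleftrightarrow> (\<forall>S. card S \<noteq> k \<longrightarrow> c S = 0)"

text \<open>Lets facts about columns, such as \<open>sum_gram_DFab\<close>, serve for rows as
  well.\<close>

lemma mtransp_Fab: "mtransp (Fab n c a b z) = Fab n (\<lambda>J I. c I J) b a z"
  by (auto simp: mtransp_def Fab_def fun_eq_iff Un_commute Int_commute)

lemma mtransp_DFab: "mtransp (DFab n c a b i z) = DFab n (\<lambda>J I. c I J) b a i z"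
  by (auto simp: mtransp_def DFab_def fun_eq_iff Un_commute Int_commute)

text \<open>The extra derivative moves \<open>i\<close> into the column index. If \<open>i\<close>
  already lies in the row set, both sides are 0: no variable survives a second derivative, and the
  row set meets \<open>insert i B\<close>.\<close>

lemma DFab_eq_Fab:
  assumes "finite B"
  shows "DFab n c a b i z x (J, B) = (if i \<notin> B then Fab n c a (Suc b) z x (J, insert i B) else 0)"
proof -
  have "mlpoly n (\<lambda>_. 0) z = 0"
    by (simp add: mlpoly_def)
  then show ?thesis
    using assms by (cases x) (auto simp: DFab_def Fab_def ml_deriv_singleton)
qed

text \<open>By \<open>DFab_eq_Fab\<close> a column of the next matrix, with its set of size b + 1,
  is produced by each of the b + 1 choices of \<open>i\<close> in that set.\<close>

lemma sum_gram_DFab: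
  fixes n :: nat and c :: "'i \<Rightarrow> 'j::finite \<Rightarrow> nat set \<Rightarrow> real"
  defines "C \<equiv> (UNIV :: 'j set) \<times> Pow {..<n}"
  shows "(\<Sum>i<n. gram C (DFab n c a b i z) x x') = real (Suc b) * gram C (Fab n c a (Suc b) z) x x'"
proof -
  define g where "g = (\<lambda>J B. Fab n c a (Suc b) z x (J, B) * Fab n c a (Suc b) z x' (J, B))"
  have g0: "g J B = 0" if "card B \<noteq> Suc b" for J B
    using that by (cases x) (auto simp: g_def Fab_def)
  have gram: "gram C M x x' = (\<Sum>J\<in>UNIV. \<Sum>B\<in>Pow {..<n}. M x (J, B) * M x' (J, B))"
    for M :: "'i \<times> nat set \<Rightarrow> 'j \<times> nat set \<Rightarrow> real"
    by (simp add: gram_def C_def sum.cartesian_product split_def)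
  have "(\<Sum>i<n. gram C (DFab n c a b i z) x x')
      = (\<Sum>i<n. \<Sum>J\<in>UNIV. \<Sum>B\<in>Pow {..<n}. if i \<notin> B then g J (insert i B) else 0)"
    unfolding gram by (intro sum.cong refl) (auto simp: DFab_eq_Fab g_def finite_subset[OF _ finite_lessThan])
  also have "\<dots> = (\<Sum>J\<in>UNIV. \<Sum>i<n. \<Sum>B\<in>Pow {..<n}. if i \<notin> B then g J (insert i B) else 0)"
    by (rule sum.swap)
  also have "\<dots> = (\<Sum>J\<in>UNIV. \<Sum>B\<in>Pow {..<n}. real (card B) * g J B)"
    by (intro sum.cong refl sum_Pow_insert) simp
  also have "\<dots> = (\<Sum>J\<in>UNIV. \<Sum>B\<in>Pow {..<n}. real (Suc b) * g J B)"
    by (intro sum.cong refl) (metis g0 mult_zero_right)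
  also have "\<dots> = real (Suc b) * gram C (Fab n c a (Suc b) z) x x'"
    by (simp only: gram sum_distrib_left g_def)
  finally show ?thesis .
qed

text \<open>\<open>expect_mtr_mpow_le\<close> for the dilation of \<open>Fab\<close>, whose entries
  are homogeneous of degree k - (a + b). The 2 on the left appears because the dilation counts
  \<open>Fab\<close> twice, whereas the two diagonal blocks on the right each count once.\<close>

lemma schatten_pow_Fab_step:
  fixes n :: nat and c :: "'i::finite \<Rightarrow> 'j::finite \<Rightarrow> nat set \<Rightarrow> real"
  assumes hom: "\<And>I J. homogeneous k (c I J)" and ab: "a + b < k" and m: "m \<ge> 1"
  defines "R \<equiv> (UNIV :: 'i set) \<times> Pow {..<n}" and "C \<equiv> (UNIV :: 'j set) \<times> Pow {..<n}"
  shows "2 * expect n (\<lambda>z. schatten_pow R C (Fab n c a b z) m)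
    \<le> (real (2 * m - 1) / real (k - (a + b))) ^ m *
      (real (Suc b) ^ m * expect n (\<lambda>z. schatten_pow R C (Fab n c a (Suc b) z) m)
       + real (Suc a) ^ m * expect n (\<lambda>z. schatten_pow R C (Fab n c (Suc a) b z) m))"
proof -
  have fin: "finite R" "finite C" by (simp_all add: R_def C_def)
  let ?K = "R <+> C"
  define r where "r = real (2 * m - 1) / real (k - (a + b))"
  define X where "X = (\<lambda>z. dilation (Fab n c a b z))"
  define D where "D = (\<lambda>i z. dilation (DFab n c a b i z))"
  have diff: "Fab n c a b z x y - Fab n c a b (flip i z) x y = 2 * z i * DFab n c a b i z x y"
    if "i < n" for i z x y
    using mlpoly_diff_flip[OF that] by (cases x; cases y) (simp add: Fab_def DFab_def)
  have flip: "DFab n c a b i (flip i z) = DFab n c a b i z" for i z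
  proof -
    have "mlpoly n (ml_deriv {i} g) (flip i z) = mlpoly n (ml_deriv {i} g) z" for g
      by (rule mlpoly_flip) (simp add: ml_deriv_def)
    then show ?thesis by (auto simp: DFab_def fun_eq_iff)
  qed
  have euler: "real (k - (a + b)) * Fab n c a b z x y = (\<Sum>i<n. z i * DFab n c a b i z x y)"
    if xy: "x \<in> R" "y \<in> C" for z x y
  proof -
    obtain I A J B where [simp]: "x = (I, A)" "y = (J, B)" by (cases x; cases y)
    have finAB: "finite A" "finite B" using xy by (auto simp: R_def C_def intro: finite_subset)
    show ?thesis
    proof (cases "card A = a \<and> card B = b \<and> A \<inter> B = {}")
      case True
      have "ml_deriv (A \<union> B) (c I J) S = 0" if "S \<subseteq> {..<n}" "card S \<noteq> k - (a + b)" for S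
      proof (cases "S \<inter> (A \<union> B) = {}")
        case disj: True
        have "finite S" using that by (auto intro: finite_subset)
        then have "card (S \<union> (A \<union> B)) = card S + (a + b)"
          using True finAB disj by (simp add: card_Un_disjoint)
        then have "card (S \<union> (A \<union> B)) \<noteq> k" using that by simp
        then show ?thesis using hom by (simp add: ml_deriv_def homogeneous_def)
      qed (simp add: ml_deriv_def)
      from mlpoly_euler[OF this] True show ?thesis
        by (simp add: Fab_def DFab_def)
    qed (auto simp: Fab_def DFab_def intro!: sum.neutral)
  qed
  have "2 * expect n (\<lambda>z. schatten_pow R C (Fab n c a b z) m) = expect n (\<lambda>z. mtr ?K (mpow ?K (X z) (2 * m)))"
    by (simp only: X_def mtr_mpow_dilation[OF fin m] expect_cmult)
  also have "\<dots> \<le> r ^ m * expect n (\<lambda>z. mtr ?K (mpow ?K (\<lambda>x y. \<Sum>i<n. mmul ?K (D i z) (D i z) x y) m))"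
    unfolding r_def
  proof (rule expect_mtr_mpow_le)
    show "X z x y - X (flip i z) x y = 2 * z i * D i z x y" if "i < n" "z \<in> cube n" for i z x y
      using diff[OF that(1)] by (auto simp: X_def D_def dilation_def split: sum.splits)
    show "real (k - (a + b)) * X z x y = (\<Sum>i<n. z i * D i z x y)" if "x \<in> ?K" "y \<in> ?K" for z x y
      using that euler by (auto simp: X_def D_def dilation_def)
    show "D i (flip i z) = D i z" for i z
      by (simp add: D_def flip)
  qed (use fin m ab in \<open>auto simp: X_def D_def\<close>)
  also have "\<dots> = r ^ m * expect n (\<lambda>z. real (Suc b) ^ m * schatten_pow R C (Fab n c a (Suc b) z) m
      + real (Suc a) ^ m * schatten_pow R C (Fab n c (Suc a) b z) m)"
  proof (intro arg_cong2[of _ _ _ _ "(*)"] refl expect_cong)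
    fix z
    let ?P = "\<lambda>x y. real (Suc b) * gram C (Fab n c a (Suc b) z) x y"
    let ?Q = "\<lambda>x y. real (Suc a) * gram R (mtransp (Fab n c (Suc a) b z)) x y"
    \<comment> \<open>The second block is the first one for the transposed matrix, with the roles of
      a and b exchanged.\<close>
    have Q: "(\<Sum>i<n. gram R (mtransp (DFab n c a b i z)) x y) = ?Q x y" for x y
      unfolding mtransp_DFab mtransp_Fab R_def by (rule sum_gram_DFab)
    have "(\<Sum>i<n. mmul ?K (D i z) (D i z) x y) = block_diag ?P ?Q x y" if "x \<in> ?K" "y \<in> ?K" for x y
    proof -
      have "(\<Sum>i<n. mmul ?K (D i z) (D i z) x y)
          = (\<Sum>i<n. block_diag (gram C (DFab n c a b i z)) (gram R (mtransp (DFab n c a b i z))) x y)"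
        by (simp only: D_def mmul_dilation[OF fin that])
      also have "\<dots> = block_diag ?P ?Q x y"
        unfolding block_diag_def Q[symmetric] C_def sum_gram_DFab[symmetric]
        by (auto split: sum.splits)
      finally show ?thesis .
    qed
    then have "mpow ?K (\<lambda>x y. \<Sum>i<n. mmul ?K (D i z) (D i z) x y) m = mpow ?K (block_diag ?P ?Q) m"
      by (rule mpow_cong)
    then show "mtr ?K (mpow ?K (\<lambda>x y. \<Sum>i<n. mmul ?K (D i z) (D i z) x y) m)
        = real (Suc b) ^ m * schatten_pow R C (Fab n c a (Suc b) z) m
          + real (Suc a) ^ m * schatten_pow R C (Fab n c (Suc a) b z) m"
      by (simp only: mpow_block_diag[OF fin] mtr_block_diag[OF fin] mpow_scale mtr_scale
          schatten_pow_eq_mtr[symmetric] schatten_pow_mtransp[OF fin m])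
  qed
  also have "\<dots> = r ^ m * (real (Suc b) ^ m * expect n (\<lambda>z. schatten_pow R C (Fab n c a (Suc b) z) m)
       + real (Suc a) ^ m * expect n (\<lambda>z. schatten_pow R C (Fab n c (Suc a) b z) m))"
    by (simp only: expect_add expect_cmult)
  finally show ?thesis unfolding r_def .
qed

section \<open>Iteration over the order of differentiation\<close>

lemma expect_nonneg: "(\<And>z. f z \<ge> 0) \<Longrightarrow> expect n f \<ge> 0"
  by (simp add: expect_def sum_nonneg)

text \<open>A matrix with a + b = l + 1 is reached at most twice, from a - 1 or from b - 1; this is
  compensated by the 2 in \<open>schatten_pow_Fab_step\<close>.\<close>

lemma sum_schatten_pow_Fab_step:
  fixes n :: nat and c :: "'i::finite \<Rightarrow> 'j::finite \<Rightarrow> nat set \<Rightarrow> real"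
  assumes hom: "\<And>I J. homogeneous k (c I J)" and "l < k" "k \<le> d" and m: "m \<ge> 1"
  defines "R \<equiv> (UNIV :: 'i set) \<times> Pow {..<n}" and "C \<equiv> (UNIV :: 'j set) \<times> Pow {..<n}"
  shows "(\<Sum>a\<le>l. expect n (\<lambda>z. schatten_pow R C (Fab n c a (l - a) z) m))
    \<le> (2 * real m * real d) ^ m * (\<Sum>a\<le>Suc l. expect n (\<lambda>z. schatten_pow R C (Fab n c a (Suc l - a) z) m))"
proof -
  have fin: "finite R" "finite C" by (simp_all add: R_def C_def)
  define e where "e = (\<lambda>a b. expect n (\<lambda>z. schatten_pow R C (Fab n c a b z) m))"
  define K where "K = (2 * real m * real d) ^ m"
  have e0: "e a b \<ge> 0" for a b
    unfolding e_def by (intro expect_nonneg schatten_pow_nonneg fin m)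
  have K0: "K \<ge> 0" by (simp add: K_def)
  have K: "(real (2 * m - 1) / real (k - l)) ^ m * (real (Suc b) ^ m * x) \<le> K * x" if "b \<le> l" "x \<ge> 0" for b x
  proof -
    \<comment> \<open>The constant: k - l >= 1, 2m - 1 <= 2m, and b + 1 <= l + 1 <= k <= d.\<close>
    have "real (2 * m - 1) / real (k - l) * real (Suc b) \<le> real (2 * m - 1) / 1 * real (Suc b)"
      using \<open>l < k\<close> by (intro mult_right_mono divide_left_mono) auto
    also have "\<dots> \<le> (2 * real m) * real d"
      using that \<open>l < k\<close> \<open>k \<le> d\<close> m by (intro mult_mono) auto
    finally have "(real (2 * m - 1) / real (k - l) * real (Suc b)) ^ m \<le> K"
      unfolding K_def by (intro power_mono) auto
    then show ?thesis
      using mult_right_mono[OF _ that(2)] unfolding power_mult_distrib mult.assoc[symmetric] by blast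
  qed
  have step: "2 * e a (l - a) \<le> K * e a (Suc l - a) + K * e (Suc a) (l - a)" if "a \<le> l" for a
  proof -
    have "2 * e a (l - a) \<le> (real (2 * m - 1) / real (k - l)) ^ m *
        (real (Suc (l - a)) ^ m * e a (Suc (l - a)) + real (Suc a) ^ m * e (Suc a) (l - a))"
      using schatten_pow_Fab_step[OF hom, of a "l - a" m n] that m \<open>l < k\<close>
      unfolding e_def R_def C_def by simp
    also have "\<dots> \<le> K * e a (Suc (l - a)) + K * e (Suc a) (l - a)"
      unfolding distrib_left using that e0 by (intro add_mono K) auto
    finally show ?thesis using that by (simp only: Suc_diff_le)
  qed
  have "2 * (\<Sum>a\<le>l. e a (l - a)) \<le> (\<Sum>a\<le>l. K * e a (Suc l - a) + K * e (Suc a) (l - a))"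
    unfolding sum_distrib_left by (intro sum_mono step) simp
  also have "\<dots> = K * ((\<Sum>a\<le>l. e a (Suc l - a)) + (\<Sum>a\<le>l. e (Suc a) (Suc l - Suc a)))"
    by (simp add: sum.distrib sum_distrib_left distrib_left)
  also have "\<dots> \<le> K * ((\<Sum>a\<le>Suc l. e a (Suc l - a)) + (\<Sum>a\<le>Suc l. e a (Suc l - a)))"
  proof (intro mult_left_mono add_mono K0)
    show "(\<Sum>a\<le>l. e a (Suc l - a)) \<le> (\<Sum>a\<le>Suc l. e a (Suc l - a))"
      using e0 by simp
    show "(\<Sum>a\<le>l. e (Suc a) (Suc l - Suc a)) \<le> (\<Sum>a\<le>Suc l. e a (Suc l - a))"
      unfolding sum.atMost_Suc_shift[of _ l] using e0 by simp
  qed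
  finally have "(\<Sum>a\<le>l. e a (l - a)) \<le> K * (\<Sum>a\<le>Suc l. e a (Suc l - a))"
    unfolding distrib_left by linarith
  then show ?thesis by (simp only: e_def K_def)
qed

lemma expect_ml_deriv: "expect n (mlpoly n (ml_deriv G c)) = c G"
  by (simp add: expect_mlpoly ml_deriv_def)

lemma EFab_eq: "EFab n c a b = (\<lambda>(I, A) (J, B). if card A = a \<and> card B = b \<and> A \<inter> B = {} then c I J (A \<union> B) else 0)"
  by (auto simp: EFab_def expect_ml_deriv fun_eq_iff)

text \<open>After a + b derivatives a polynomial homogeneous of degree a + b is constant, hence
  equal to its expectation.\<close>

lemma Fab_eq_EFab:
  assumes hom: "\<And>I J. homogeneous (a + b) (c I J)"
    and "x \<in> UNIV \<times> Pow {..<n}" "y \<in> UNIV \<times> Pow {..<n}"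
  shows "Fab n c a b z x y = EFab n c a b x y"
proof -
  obtain I A J B where [simp]: "x = (I, A)" "y = (J, B)" by (cases x; cases y)
  have finAB: "finite A" "finite B" using assms by (auto intro: finite_subset)
  show ?thesis
  proof (cases "card A = a \<and> card B = b \<and> A \<inter> B = {}")
    case True
    have "ml_deriv (A \<union> B) (c I J) S = 0" if "S \<subseteq> {..<n}" "S \<noteq> {}" for S
    proof (cases "S \<inter> (A \<union> B) = {}")
      case disj: True
      have "finite S" using that by (auto intro: finite_subset)
      then have "card (S \<union> (A \<union> B)) = card S + (a + b)" "card S > 0"
        using True finAB disj that by (simp_all add: card_Un_disjoint card_gt_0_iff)
      then show ?thesis using hom by (simp add: ml_deriv_def homogeneous_def)
    qed (simp add: ml_deriv_def)
    then have "mlpoly n (ml_deriv (A \<union> B) (c I J)) z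
        = (\<Sum>S\<in>{{}}. ml_deriv (A \<union> B) (c I J) S * (\<Prod>i\<in>S. z i))"
      unfolding mlpoly_def by (intro sum.mono_neutral_right) auto
    then show ?thesis using True by (simp add: Fab_def EFab_eq ml_deriv_def)
  qed (auto simp: Fab_def EFab_eq)
qed

lemma schatten_pow_Fab_0:
  fixes c :: "'i::finite \<Rightarrow> 'j::finite \<Rightarrow> nat set \<Rightarrow> real"
  assumes "m \<ge> 1"
  shows "schatten_pow ((UNIV :: 'i set) \<times> Pow {..<n}) ((UNIV :: 'j set) \<times> Pow {..<n}) (Fab n c 0 0 z) m
    = schatten_pow UNIV UNIV (\<lambda>I J. mlpoly n (c I J) z) m"
proof -
  have "schatten_pow ((UNIV :: 'i set) \<times> Pow {..<n}) ((UNIV :: 'j set) \<times> Pow {..<n}) (Fab n c 0 0 z) m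
      = schatten_pow UNIV UNIV (\<lambda>I J. Fab n c 0 0 z (I, {}) (J, {})) m"
  proof (rule schatten_pow_zero_padding)
    fix x :: "'i \<times> nat set" and y :: "'j \<times> nat set"
    assume "x \<in> UNIV \<times> Pow {..<n}" "y \<in> UNIV \<times> Pow {..<n}"
      "x \<notin> range (\<lambda>I. (I, {})) \<or> y \<notin> range (\<lambda>J. (J, {}))"
    then show "Fab n c 0 0 z x y = 0"
      by (cases x; cases y) (auto simp: Fab_def image_iff dest: finite_subset)
  qed (use assms in \<open>auto simp: inj_on_def\<close>)
  also have "(\<lambda>I J. Fab n c 0 0 z (I, {}) (J, {})) = (\<lambda>I J. mlpoly n (c I J) z)"
    by (simp add: Fab_def ml_deriv_def)
  finally show ?thesis .
qed

text \<open>The step lemma is iterated k times, from level 0, which is \<open>F\<close> itself, to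
  level k, where only constants remain.\<close>

lemma homogeneous_moment_bound:
  fixes c :: "'i::finite \<Rightarrow> 'j::finite \<Rightarrow> nat set \<Rightarrow> real"
  assumes hom: "\<And>I J. homogeneous k (c I J)" and "k \<le> d" and m: "m \<ge> 1"
  shows "expect n (\<lambda>z. schatten_pow UNIV UNIV (\<lambda>I J. mlpoly n (c I J) z) m)
    \<le> (2 * real m * real d) ^ (k * m) *
      (\<Sum>a\<le>k. schatten_pow (UNIV \<times> Pow {..<n}) (UNIV \<times> Pow {..<n}) (EFab n c a (k - a)) m)"
proof -
  define R where "R = (UNIV :: 'i set) \<times> Pow {..<n}"
  define C where "C = (UNIV :: 'j set) \<times> Pow {..<n}"
  define s where "s = (\<lambda>l. \<Sum>a\<le>l. expect n (\<lambda>z. schatten_pow R C (Fab n c a (l - a) z) m))"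
  have iter: "s 0 \<le> (2 * real m * real d) ^ (l * m) * s l" if "l \<le> k" for l
    using that
  proof (induction l)
    case (Suc l)
    have "s l \<le> (2 * real m * real d) ^ m * s (Suc l)"
      unfolding s_def R_def C_def using Suc.prems \<open>k \<le> d\<close> m hom
      by (intro sum_schatten_pow_Fab_step) auto
    then have "(2 * real m * real d) ^ (l * m) * s l
        \<le> (2 * real m * real d) ^ (l * m) * ((2 * real m * real d) ^ m * s (Suc l))"
      by (intro mult_left_mono) auto
    also have "\<dots> = (2 * real m * real d) ^ (Suc l * m) * s (Suc l)"
      by (simp add: power_add)
    finally show ?case using Suc by linarith
  qed simp
  have "s 0 = expect n (\<lambda>z. schatten_pow UNIV UNIV (\<lambda>I J. mlpoly n (c I J) z) m)"
    by (simp add: s_def R_def C_def schatten_pow_Fab_0[OF m])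
  moreover have "s k = (\<Sum>a\<le>k. schatten_pow R C (EFab n c a (k - a)) m)"
    unfolding s_def
  proof (intro sum.cong refl)
    fix a assume "a \<in> {..k}"
    then have "schatten_pow R C (Fab n c a (k - a) z) m = schatten_pow R C (EFab n c a (k - a)) m" for z
      unfolding R_def C_def using hom by (intro schatten_pow_cong Fab_eq_EFab) auto
    then show "expect n (\<lambda>z. schatten_pow R C (Fab n c a (k - a) z) m) = schatten_pow R C (EFab n c a (k - a)) m"
      by (simp add: expect_const)
  qed
  ultimately show ?thesis
    using iter[of k] by (simp add: R_def C_def)
qed

section \<open>Decomposition into homogeneous parts and the final bound\<close>

definition hom_part :: "nat \<Rightarrow> (nat set \<Rightarrow> real) \<Rightarrow> nat set \<Rightarrow> real" where
  "hom_part k c = (\<lambda>S. if card S = k then c S else 0)"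

lemma homogeneous_hom_part: "homogeneous k (hom_part k c)"
  by (simp add: homogeneous_def hom_part_def)

lemma mlpoly_minus_expect:
  assumes "ml_degree_le n c d"
  shows "mlpoly n c z - expect n (mlpoly n c) = (\<Sum>k\<in>{1..d}. mlpoly n (hom_part k c) z)"
proof -
  have "(\<Sum>k\<in>{1..d}. mlpoly n (hom_part k c) z)
      = (\<Sum>S\<in>Pow {..<n}. \<Sum>k\<in>{1..d}. hom_part k c S * (\<Prod>i\<in>S. z i))"
    unfolding mlpoly_def by (rule sum.swap)
  also have "\<dots> = (\<Sum>S\<in>Pow {..<n}. c S * (\<Prod>i\<in>S. z i) - (if S = {} then c {} else 0))"
  proof (intro sum.cong refl)
    fix S assume S: "S \<in> Pow {..<n}"
    then have fin: "finite S" by (auto intro: finite_subset)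
    have "(\<Sum>k\<in>{1..d}. hom_part k c S) = (if card S \<in> {1..d} then c S else 0)"
      unfolding hom_part_def by (simp add: sum.delta')
    also have "\<dots> = (if S = {} then 0 else c S)"
      using assms S fin by (auto simp: ml_degree_le_def Suc_le_eq card_gt_0_iff not_le)
    finally show "(\<Sum>k\<in>{1..d}. hom_part k c S * (\<Prod>i\<in>S. z i)) = c S * (\<Prod>i\<in>S. z i) - (if S = {} then c {} else 0)"
      by (auto simp: sum_distrib_right[symmetric])
  qed
  also have "\<dots> = mlpoly n c z - c {}"
    by (simp add: mlpoly_def sum_subtractf)
  finally show ?thesis by (simp add: expect_mlpoly)
qed

text \<open>A nonzero entry has disjoint sets of sizes a and b, so it only reads coefficients of
  sets of size k.\<close>

lemma schatten_pow_EFab_hom_part: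
  assumes "a + b = k"
  shows "schatten_pow (UNIV \<times> Pow {..<n}) (UNIV \<times> Pow {..<n}) (EFab n (\<lambda>I J. hom_part k (c I J)) a b) m
    = schatten_pow (UNIV \<times> Pow {..<n}) (UNIV \<times> Pow {..<n}) (EFab n c a b) m"
proof (rule schatten_pow_cong)
  fix x :: "'a \<times> nat set" and y :: "'b \<times> nat set"
  assume "x \<in> UNIV \<times> Pow {..<n}" "y \<in> UNIV \<times> Pow {..<n}"
  then have "finite (snd x)" "finite (snd y)"
    by (auto dest: finite_subset[OF _ finite_lessThan])
  then show "EFab n (\<lambda>I J. hom_part k (c I J)) a b x y = EFab n c a b x y"
    using assms by (cases x; cases y) (auto simp: EFab_eq hom_part_def card_Un_disjoint)
qed

lemma sum_half_powers_le: "(\<Sum>k\<in>{1..d}. (1 / 2) ^ k :: real) \<le> 1"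
proof -
  have "(\<Sum>k\<in>{1..d}. (1 / 2) ^ k :: real) = 1 - (1 / 2) ^ d"
    by (induction d) (simp_all add: field_simps)
  then show ?thesis by simp
qed

theorem mainTheorem1:
  fixes n d t :: nat
    and c :: "'i::finite \<Rightarrow> 'j::finite \<Rightarrow> nat set \<Rightarrow> real"
  assumes deg: "\<And>I J. ml_degree_le n (c I J) d"
    and t: "t \<ge> 1"
  shows "expect n (\<lambda>z. schatten_pow UNIV UNIV
            (\<lambda>I J. mlpoly n (c I J) z - expect n (mlpoly n (c I J))) t)
     \<le> (\<Sum>(a, b)\<in>{(a, b). 1 \<le> a + b \<and> a + b \<le> d}.
           (16 * real t * real d) ^ ((a + b) * t)
           * schatten_pow (UNIV \<times> Pow {..<n}) (UNIV \<times> Pow {..<n}) (EFab n c a b) t)"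
proof -
  define F where "F = (\<lambda>k z (I::'i) (J::'j). mlpoly n (hom_part k (c I J)) z)"
  define E where "E = (\<lambda>a b. schatten_pow (UNIV \<times> Pow {..<n}) (UNIV \<times> Pow {..<n}) (EFab n c a b) t)"
  have E0: "E a b \<ge> 0" for a b
    unfolding E_def by (intro schatten_pow_nonneg t) auto
  \<comment> \<open>The degree-k part is written as 2^(-k) times its multiple by 2^k: convexity
    contributes the first factor, rescaling the second. Dropping the first leaves 4^(kt).\<close>
  have weights: "(1 / 2) ^ k * (2 ^ k) ^ (2 * t) \<le> (4 :: real) ^ (k * t)" for k
  proof -
    have "(1 / 2 :: real) ^ k * (2 ^ k) ^ (2 * t) \<le> 1 * (2 ^ k) ^ (2 * t)"
      by (intro mult_right_mono power_le_one) auto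
    also have "\<dots> = (2 ^ 2) ^ (k * t)"
      by (simp only: power_mult[symmetric] mult_1 ac_simps)
    finally show ?thesis by simp
  qed
  have part: "expect n (\<lambda>z. (1 / 2) ^ k * schatten_pow UNIV UNIV (\<lambda>I J. 2 ^ k * F k z I J) t)
      \<le> (16 * real t * real d) ^ (k * t) * (\<Sum>a\<le>k. E a (k - a))" if k: "k \<in> {1..d}" for k
  proof -
    define e where "e = expect n (\<lambda>z. schatten_pow UNIV UNIV (F k z) t)"
    have e0: "e \<ge> 0"
      unfolding e_def by (intro expect_nonneg schatten_pow_nonneg t) auto
    have "e \<le> (2 * real t * real d) ^ (k * t) * (\<Sum>a\<le>k. E a (k - a))"
    proof -
      have "e \<le> (2 * real t * real d) ^ (k * t) *
          (\<Sum>a\<le>k. schatten_pow (UNIV \<times> Pow {..<n}) (UNIV \<times> Pow {..<n}) (EFab n (\<lambda>I J. hom_part k (c I J)) a (k - a)) t)"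
        unfolding e_def F_def using k t by (intro homogeneous_moment_bound homogeneous_hom_part) auto
      also have "\<dots> = (2 * real t * real d) ^ (k * t) * (\<Sum>a\<le>k. E a (k - a))"
        unfolding E_def by (intro arg_cong2[of _ _ _ _ "(*)"] sum.cong refl schatten_pow_EFab_hom_part) auto
      finally show ?thesis .
    qed
    then have "4 ^ (k * t) * e \<le> 4 ^ (k * t) * ((2 * real t * real d) ^ (k * t) * (\<Sum>a\<le>k. E a (k - a)))"
      by (intro mult_left_mono) auto
    also have "\<dots> = (4 * (2 * real t * real d)) ^ (k * t) * (\<Sum>a\<le>k. E a (k - a))"
      by (simp only: power_mult_distrib mult.assoc)
    \<comment> \<open>The product 4 times 2 gives 8, within the stated 16.\<close>
    also have "\<dots> \<le> (16 * real t * real d) ^ (k * t) * (\<Sum>a\<le>k. E a (k - a))"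
      using E0 by (intro mult_right_mono power_mono sum_nonneg) auto
    finally have "4 ^ (k * t) * e \<le> (16 * real t * real d) ^ (k * t) * (\<Sum>a\<le>k. E a (k - a))" .
    moreover have "expect n (\<lambda>z. (1 / 2) ^ k * schatten_pow UNIV UNIV (\<lambda>I J. 2 ^ k * F k z I J) t)
        = ((1 / 2) ^ k * (2 ^ k) ^ (2 * t)) * e"
      by (simp only: schatten_pow_scale expect_cmult e_def mult.assoc)
    ultimately show ?thesis
      using mult_right_mono[OF weights[of k] e0] by linarith
  qed
  have "expect n (\<lambda>z. schatten_pow UNIV UNIV
            (\<lambda>I J. mlpoly n (c I J) z - expect n (mlpoly n (c I J))) t)
      \<le> expect n (\<lambda>z. \<Sum>k\<in>{1..d}. (1 / 2) ^ k * schatten_pow UNIV UNIV (\<lambda>I J. 2 ^ k * F k z I J) t)"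
  proof (rule expect_mono)
    fix z
    have "(\<lambda>I J. mlpoly n (c I J) z - expect n (mlpoly n (c I J)))
        = (\<lambda>I J. \<Sum>k\<in>{1..d}. (1 / 2) ^ k * (2 ^ k * F k z I J))"
      unfolding mlpoly_minus_expect[OF deg] F_def
      by (simp add: mult.assoc[symmetric] power_mult_distrib[symmetric])
    then show "schatten_pow UNIV UNIV (\<lambda>I J. mlpoly n (c I J) z - expect n (mlpoly n (c I J))) t
        \<le> (\<Sum>k\<in>{1..d}. (1 / 2) ^ k * schatten_pow UNIV UNIV (\<lambda>I J. 2 ^ k * F k z I J) t)"
      using schatten_pow_convex[OF finite finite t _ sum_half_powers_le[of d], where M = "\<lambda>k I J. 2 ^ k * F k z I J"]
      by simp
  qed
  also have "\<dots> = (\<Sum>k\<in>{1..d}. expect n (\<lambda>z. (1 / 2) ^ k * schatten_pow UNIV UNIV (\<lambda>I J. 2 ^ k * F k z I J) t))"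
    by (rule expect_sum)
  also have "\<dots> \<le> (\<Sum>k\<in>{1..d}. (16 * real t * real d) ^ (k * t) * (\<Sum>a\<le>k. E a (k - a)))"
    by (intro sum_mono part)
  also have "\<dots> = (\<Sum>(k, a)\<in>Sigma {1..d} (\<lambda>k. {..k}). (16 * real t * real d) ^ (k * t) * E a (k - a))"
    by (simp add: sum_distrib_left sum.Sigma)
  \<comment> \<open>Pairs (k, a) with a <= k correspond to pairs (a, b) through b = k - a.\<close>
  also have "\<dots> = (\<Sum>(a, b)\<in>{(a, b). 1 \<le> a + b \<and> a + b \<le> d}. (16 * real t * real d) ^ ((a + b) * t) * E a b)"
    by (rule sum.reindex_bij_witness[of _ "\<lambda>(a, b). (a + b, a)" "\<lambda>(k, a). (a, k - a)"]) auto
  finally show ?thesis by (simp only: E_def)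
qed

end
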